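(* Let $p\geq 5$ be prime. There are exactly $p+1$ points (corresponding to the points of $\mathbb{P}^1_{\mathbb{F}_p}$) $(a_0:\ldots:a_{\frac{p-1}{2}})\in\mathbb{P}^{\frac{p-1}{2}}$ (over $\mathbb{C}$) for which the corresponding $H_p$-Clifford algebra $\mathfrak{C}(a_0:\ldots:a_{\frac{p-1}{2}})$ is isomorphic to the quantum space $\mathbb{C}_{-1}[x_0,\ldots,x_{p-1}]$.
   Context: Indices of the variables $x_i$ are taken in $\mathbb{Z}/p\mathbb{Z}$, and $\frac{i}{2}$ in an index means $i\cdot 2^{-1}$ modulo $p$. For a point $(a_0:\ldots:a_{\frac{p-1}{2}})\in \mathbb{P}^{\frac{p-1}{2}}$ (over $\mathbb{C}$), the $H_p$-Clifford algebra $\mathfrak{C}(a_0:\ldots:a_{\frac{p-1}{2}})$ is the quotient of the free algebra $\mathbb{C}\langle x_0,\ldots,x_{p-1}\rangle$ by the relations $$a_0(x_jx_{j+i}+x_{j+i}x_j)=a_i\,x_{j+\frac{i}{2}}^2,\qquad j\in\mathbb{Z}/p\mathbb{Z},\ 1\le i\le \tfrac{p-1}{2},$$ together with the relations (automatic if $a_0\neq 0$) $$a_m\left(x_{k-\frac i2}x_{k+\frac i2}+x_{k+\frac i2}x_{k-\frac i2}\right)=a_i\left(x_{k-\frac m2}x_{k+\frac m2}+x_{k+\frac m2}x_{k-\frac m2}\right),\qquad k\in\mathbb{Z}/p\mathbb{Z},\ 1\le i,m\le \tfrac{p-1}{2}.$$ $\mathbb{C}_{-1}[x_0,\ldots,x_{p-1}]$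 is the algebra with generators $x_0,\ldots,x_{p-1}$ and defining relations $x_ix_j=-x_jx_i$ for $i\ne j$. *)

theory Defs
  imports Complex_Main "HOL-Library.Poly_Mapping" "HOL-Algebra.QuotRing" "HOL-Algebra.Module"
    "HOL-Number_Theory.Residues" "HOL-Number_Theory.Modular_Inverse"
begin

section \<open>Free algebras\<close>

text \<open>The free monoid, written additively so that \<open>'a word \<Rightarrow>\<^sub>0 complex\<close>
  is its monoid algebra, i.e. the free algebra on the type \<open>'a\<close>.\<close>

datatype 'a word = Word (letters: "'a list")

instantiation word :: (type) monoid_add
begin

definition zero_word :: "'a word" where "0 = Word []"

definition plus_word :: "'a word \<Rightarrow> 'a word \<Rightarrow> 'a word"
  where "u + v = Word (letters u @ letters v)"

instance
  by standard (simp_all add: zero_word_def plus_word_def)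

end

definition scal :: "complex \<Rightarrow> ('a word \<Rightarrow>\<^sub>0 complex) \<Rightarrow> ('a word \<Rightarrow>\<^sub>0 complex)"
  where "scal c f = Poly_Mapping.map ((*) c) f"

definition free_algebra :: "'a set \<Rightarrow> (complex, 'a word \<Rightarrow>\<^sub>0 complex) module"
  where "free_algebra X =
    \<lparr>carrier = {f. \<forall>w \<in> Poly_Mapping.keys f. set (letters w) \<subseteq> X},
     monoid.mult = (*), one = 1, zero = 0, add = (+), smult = scal\<rparr>"

definition var :: "'a \<Rightarrow> ('a word \<Rightarrow>\<^sub>0 complex)"
  where "var a = Poly_Mapping.single (Word [a]) 1"


section \<open>Quotient algebras and isomorphisms\<close>

text \<open>The ring \<open>A Quot I\<close> with \<open>c \<odot> (I + x) = I + c \<odot> x\<close>.\<close>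

definition quot_algebra ::
    "('k, 'a) module \<Rightarrow> 'a set \<Rightarrow> ('k, 'a set) module" (infixl \<open>AlgQuot\<close> 65)
  where "A AlgQuot I =
    ring.extend (A Quot I) (module.fields (\<lambda>c Z. \<Union>x\<in>Z. I +>\<^bsub>A\<^esub> (c \<odot>\<^bsub>A\<^esub> x)))"

definition algebra_isomorphic :: "('k, 'a) module \<Rightarrow> ('k, 'b) module \<Rightarrow> bool"
    (infix \<open>\<simeq>\<^sub>a\<^sub>l\<^sub>g\<close> 50)
  where "A \<simeq>\<^sub>a\<^sub>l\<^sub>g B \<longleftrightarrow>
    (\<exists>h \<in> ring_iso A B. \<forall>c. \<forall>x \<in> carrier A. h (c \<odot>\<^bsub>A\<^esub> x) = c \<odot>\<^bsub>B\<^esub> h x)"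


section \<open>Projective spaces\<close>

definition nonzero_vectors :: "('a, 'm) ring_scheme \<Rightarrow> nat \<Rightarrow> (nat \<Rightarrow> 'a) set"
  where "nonzero_vectors K n =
    ({0..n} \<rightarrow>\<^sub>E carrier K) - {\<lambda>i\<in>{0..n}. \<zero>\<^bsub>K\<^esub>}"

text \<open>A point of \<open>\<bbbP>\<^sup>n(K)\<close> is the set of all its vectors of homogeneous coordinates.\<close>

definition proj_space :: "('a, 'm) ring_scheme \<Rightarrow> nat \<Rightarrow> (nat \<Rightarrow> 'a) set set"
  where "proj_space K n = nonzero_vectors K n //
    {(v, w). v \<in> nonzero_vectors K n \<and> w \<in> nonzero_vectors K n \<and>
       (\<exists>c \<in> carrier K - {\<zero>\<^bsub>K\<^esub>}. w = (\<lambda>i\<in>{0..n}. c \<otimes>\<^bsub>K\<^esub> v i))}"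

definition complex_field :: "complex ring"
  where "complex_field =
    \<lparr>carrier = UNIV, monoid.mult = (*), one = 1, zero = 0, add = (+)\<rparr>"


section \<open>Clifford algebras and quantum spaces\<close>

text \<open>\<open>\<int>/p\<int>\<close> is represented by \<open>{0..<int p}\<close>; \<open>gen p j\<close> is the variable
  with index the class of \<open>j\<close> modulo \<open>p\<close>.\<close>

definition gen :: "nat \<Rightarrow> int \<Rightarrow> (int word \<Rightarrow>\<^sub>0 complex)"
  where "gen p j = var (j mod int p)"

definition half :: "nat \<Rightarrow> nat \<Rightarrow> int"
  where "half p i = int i * modular_inverse (int p) 2"

definition anticomm :: "'r::ring \<Rightarrow> 'r \<Rightarrow> 'r"
  where "anticomm f g = f * g + g * f"

definition clifford_relations :: "nat \<Rightarrow> (nat \<Rightarrow> complex) \<Rightarrow> (int word \<Rightarrow>\<^sub>0 complex) set"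
  where "clifford_relations p a =
    {scal (a 0) (anticomm (gen p j) (gen p (j + int i)))
       - scal (a i) ((gen p (j + half p i))\<^sup>2)
     | j i. j \<in> {0..<int p} \<and> i \<in> {1..(p - 1) div 2}} \<union>
    {scal (a m) (anticomm (gen p (k - half p i)) (gen p (k + half p i)))
       - scal (a i) (anticomm (gen p (k - half p m)) (gen p (k + half p m)))
     | k i m. k \<in> {0..<int p} \<and> i \<in> {1..(p - 1) div 2} \<and> m \<in> {1..(p - 1) div 2}}"

definition clifford_algebra :: "nat \<Rightarrow> (nat \<Rightarrow> complex) \<Rightarrow> (complex, (int word \<Rightarrow>\<^sub>0 complex) set) module"
  where "clifford_algebra p a =
    free_algebra {0..<int p} AlgQuot (Idl\<^bsub>free_algebra {0..<int p}\<^esub> (clifford_relations p a))"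

definition quantum_space :: "nat \<Rightarrow> (complex, (int word \<Rightarrow>\<^sub>0 complex) set) module"
  where "quantum_space p =
    free_algebra {0..<int p} AlgQuot (Idl\<^bsub>free_algebra {0..<int p}\<^esub>
      {anticomm (gen p i) (gen p j)
       | i j. i \<in> {0..<int p} \<and> j \<in> {0..<int p} \<and> i \<noteq> j})"


section \<open>Well-definedness\<close>

lemma lookup_scal [simp]: "Poly_Mapping.lookup (scal c f) w = c * Poly_Mapping.lookup f w"
  by (simp add: scal_def Poly_Mapping.map.rep_eq when_def)

lemma scal_scal: "scal c (scal d f) = scal (c * d) f"
  by (rule poly_mapping_eqI) simp

lemma scal_diff: "scal c (f - g) = scal c f - scal c g"
  by (rule poly_mapping_eqI) (simp add: lookup_minus algebra_simps)

lemma scal_conv_mult: "scal c f = Poly_Mapping.single 0 c * f"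
  by (simp add: scal_def mult_map_scale_conv_mult)

lemma ring_free_algebra: "ring (free_algebra X)"
proof (rule ringI)
  show "abelian_group (free_algebra X)"
  proof (rule abelian_groupI)
    fix f assume "f \<in> carrier (free_algebra X)"
    then have "- f \<in> carrier (free_algebra X)" "- f \<oplus>\<^bsub>free_algebra X\<^esub> f = \<zero>\<^bsub>free_algebra X\<^esub>"
      by (auto simp: free_algebra_def)
    then show "\<exists>g \<in> carrier (free_algebra X). g \<oplus>\<^bsub>free_algebra X\<^esub> f = \<zero>\<^bsub>free_algebra X\<^esub>"
      by blast
  next
    fix f g assume "f \<in> carrier (free_algebra X)" "g \<in> carrier (free_algebra X)"
    then show "f \<oplus>\<^bsub>free_algebra X\<^esub> g \<in> carrier (free_algebra X)"
      using Poly_Mapping.keys_add[of f g] by (auto simp: free_algebra_def)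
  qed (simp_all add: free_algebra_def algebra_simps)
  show "Group.monoid (free_algebra X)"
  proof (rule monoidI)
    fix f g assume fg: "f \<in> carrier (free_algebra X)" "g \<in> carrier (free_algebra X)"
    have "set (letters w) \<subseteq> X" if "w \<in> Poly_Mapping.keys (f * g)" for w
    proof -
      from that obtain u v where "w = u + v" "u \<in> Poly_Mapping.keys f" "v \<in> Poly_Mapping.keys g"
        using keys_mult[of f g] by blast
      with fg show ?thesis
        by (auto simp: free_algebra_def plus_word_def)
    qed
    then show "f \<otimes>\<^bsub>free_algebra X\<^esub> g \<in> carrier (free_algebra X)"
      by (auto simp: free_algebra_def)
  qed (auto simp: free_algebra_def zero_word_def mult.assoc)
qed (auto simp: free_algebra_def algebra_simps)

text \<open>The Clifford algebra depends only on the point with homogeneous coordinates \<open>a\<close>.\<close>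

lemma clifford_relations_scale:
  assumes "\<And>i. i \<le> (p - 1) div 2 \<Longrightarrow> b i = c * a i"
  shows "clifford_relations p b = scal c ` clifford_relations p a"
proof -
  let ?r = "\<lambda>a j i. scal (a 0) (anticomm (gen p j) (gen p (j + int i)))
      - scal (a i) ((gen p (j + half p i))\<^sup>2)"
  let ?s = "\<lambda>a k i m. scal (a m) (anticomm (gen p (k - half p i)) (gen p (k + half p i)))
      - scal (a i) (anticomm (gen p (k - half p m)) (gen p (k + half p m)))"
  let ?J = "{0..<int p}" and ?I = "{1..(p - 1) div 2}"
  have eq: "clifford_relations p a =
      (\<lambda>(j, i). ?r a j i) ` (?J \<times> ?I) \<union> (\<lambda>(k, i, m). ?s a k i m) ` (?J \<times> ?I \<times> ?I)" for a
  proof -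
    have 1: "{f j i | j i. j \<in> A \<and> i \<in> B} = (\<lambda>(j, i). f j i) ` (A \<times> B)"
      for f :: "int \<Rightarrow> nat \<Rightarrow> int word \<Rightarrow>\<^sub>0 complex" and A B by auto
    have 2: "{f k i m | k i m. k \<in> A \<and> i \<in> B \<and> m \<in> B} = (\<lambda>(k, i, m). f k i m) ` (A \<times> B \<times> B)"
      for f :: "int \<Rightarrow> nat \<Rightarrow> nat \<Rightarrow> int word \<Rightarrow>\<^sub>0 complex" and A B by force
    show ?thesis
      unfolding clifford_relations_def 1 2 ..
  qed
  have "?r b j i = scal c (?r a j i)" if "i \<in> ?I" for j i
    using that assms[of 0] assms[of i] by (simp add: scal_diff scal_scal)
  moreover have "?s b k i m = scal c (?s a k i m)" if "i \<in> ?I" "m \<in> ?I" for k i m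
    using that assms[of m] assms[of i] by (simp add: scal_diff scal_scal)
  ultimately show ?thesis
    unfolding eq image_Un image_image
    by (intro arg_cong2[where f = "(\<union>)"] image_cong) auto
qed

lemma ideal_scal_iff:
  assumes "ideal I (free_algebra X)" "c \<noteq> 0"
  shows "scal c f \<in> I \<longleftrightarrow> f \<in> I"
proof -
  have *: "scal d g \<in> I" if "g \<in> I" for d g
  proof -
    have "Poly_Mapping.single 0 d \<in> carrier (free_algebra X)"
      by (simp add: free_algebra_def zero_word_def)
    from ideal.I_l_closed[OF assms(1) that this] show ?thesis
      by (simp add: free_algebra_def scal_conv_mult)
  qed
  have "scal (1 / c) (scal c f) = f"
    using assms(2) by (intro poly_mapping_eqI) simp
  then show ?thesis using * by metis
qed

lemma clifford_algebra_scale: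
  assumes "c \<noteq> 0" "\<And>i. i \<le> (p - 1) div 2 \<Longrightarrow> b i = c * a i"
  shows "clifford_algebra p b = clifford_algebra p a"
proof -
  let ?A = "free_algebra {0..<int p}"
  have "scal c ` R \<subseteq> I \<longleftrightarrow> R \<subseteq> I" if "ideal I ?A" for R I
    using ideal_scal_iff[OF that assms(1)] by auto
  moreover have "clifford_relations p b = scal c ` clifford_relations p a"
    using assms(2) by (rule clifford_relations_scale)
  ultimately have "Idl\<^bsub>?A\<^esub> (clifford_relations p b) = Idl\<^bsub>?A\<^esub> (clifford_relations p a)"
    unfolding genideal_def by (metis (no_types, lifting))
  then show ?thesis by (simp add: clifford_algebra_def)
qed

lemma clifford_algebra_point:
  assumes "P \<in> proj_space complex_field ((p - 1) div 2)" "a \<in> P" "b \<in> P"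
  shows "clifford_algebra p a = clifford_algebra p b"
proof -
  from assms(1) obtain v where P: "\<forall>w \<in> P. \<exists>c. c \<noteq> 0 \<and> w = (\<lambda>i\<in>{0..(p - 1) div 2}. c * v i)"
    by (auto simp: proj_space_def quotient_def complex_field_def)
  have "clifford_algebra p w = clifford_algebra p v" if "w \<in> P" for w
    using P that by (metis (no_types, lifting) atLeastAtMost_iff clifford_algebra_scale le0 restrict_apply')
  with assms(2,3) show ?thesis by simp
qed

end

theory Submission
  imports Defs
begin

text \<open>Everything is decided by the characters of the algebras, that is, by the common zeros
\<open>\<mu> \<in> \<complex>\<^sup>p\<close> of their defining relations.

\<^emph>\<open>Necessity.\<close> The quantum space has many characters: the relations
\<open>x\<^sub>i x\<^sub>j + x\<^sub>j x\<^sub>i\<close> vanish wherever at most one coordinate is nonzero. An isomorphism,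
graded or not, transports characters, and a character is determined by its values on the
generators. So if \<open>\<C>(a)\<close> is isomorphic to the quantum space, then the relations of \<open>\<C>(a)\<close> have a
zero \<open>\<mu> \<noteq> 0\<close> (lemma \<open>nonzero_point_if_iso_quantum\<close>). The relations at such a zero read
\<open>2 a\<^sub>0 \<mu>\<^sub>j \<mu>\<^sub>j\<^sub>+\<^sub>i = a\<^sub>i \<mu>\<^sub>m\<^sup>2\<close> with \<open>m\<close> the midpoint of \<open>j\<close> and \<open>j + i\<close>. If \<open>a\<^sub>0 = 0\<close>, then
another \<open>a\<^sub>i\<close> is nonzero and all \<open>\<mu>\<^sub>m\<close> vanish, a contradiction.
If some \<open>a\<^sub>i \<noteq> 0\<close> with \<open>i \<ge> 1\<close>, then nonvanishing of one coordinate spreads in steps of \<open>i/2\<close> to all of \<open>\<int>/p\<int>\<close>, and the successive ratios \<open>\<mu>\<^sub>m\<^sub>+\<^sub>1 / \<mu>\<^sub>m\<close> form a geometric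
progression with quotient \<open>q = a\<^sub>2 / (2 a\<^sub>0)\<close>. Periodicity forces \<open>q\<^sup>p = 1\<close>, and
\<open>\<mu>\<^sub>m\<^sub>-\<^sub>d \<mu>\<^sub>m\<^sub>+\<^sub>d = q^(d\<^sup>2) \<mu>\<^sub>m\<^sup>2\<close> determines all \<open>a\<^sub>i\<close>: with \<open>\<zeta> = exp (2 \<pi> \<i> / p)\<close> there is
\<open>c\<close> modulo \<open>p\<close> such that \<open>a\<^sub>i = 2 a\<^sub>0 \<zeta>^(c i\<^sup>2)\<close> for all \<open>i \<ge> 1\<close>
(lemma \<open>coefficients_of_common_zero\<close>). The remaining case is \<open>a = (1 : 0 : \<dots> : 0)\<close>, the value
\<open>c = \<infinity>\<close>.

\<^emph>\<open>Sufficiency.\<close> For \<open>c = \<infinity>\<close> the relations are those of the quantum space. For finite \<open>c\<close> the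
Fourier transform twisted by a quadratic phase, \<open>x\<^sub>j \<mapsto> \<Sum>\<^sub>k \<zeta>^(k j + 2 c j\<^sup>2) x\<^sub>k\<close>,
is an invertible linear substitution that carries the relations of the Clifford algebra into
the ideal of the quantum space and whose inverse does the converse
(lemmas \<open>fourier_clifford_relation\<close>, \<open>inv_fourier_quantum_relation\<close>). In terms of symmetric forms, the
\<open>p\<close>-dimensional system orthogonal to the relations is spanned by \<open>p\<close> squares of linear forms.

The points \<open>c \<in> \<int>/p\<int> \<union> {\<infinity>}\<close> are pairwise distinct and are matched with the points of the
projective line over \<open>\<int>/p\<int>\<close>.\<close>

section \<open>Evaluation of noncommutative polynomials\<close>

lemma poly_mapping_sum_monomials:
  "(\<Sum>w\<in>Poly_Mapping.keys f. Poly_Mapping.single w (Poly_Mapping.lookup f w)) = f"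
  by (rule poly_mapping_eqI)
     (auto simp: lookup_sum lookup_single when_def in_keys_iff sum.delta)

lemma letters_zero [simp]: "letters 0 = []"
  by (simp add: zero_word_def)

lemma letters_plus [simp]: "letters (u + v) = letters u @ letters v"
  by (simp add: plus_word_def)

text \<open>The universal property of the free algebra is needed for two kinds of targets: \<open>\<complex>\<close>, where
evaluations are characters, and another free algebra, where they are substitutions. Both are
covered by a ring into which the scalars are embedded centrally.\<close>

locale scalar_embedding =
  fixes e :: "complex \<Rightarrow> 'b::ring_1"
  assumes e_add: "e (c + d) = e c + e d"
    and e_mult: "e (c * d) = e c * e d"
    and e_one: "e 1 = 1"
    and e_central: "e c * x = x * e c"
begin

lemma e_zero: "e 0 = 0"
  using e_add[of 0 0] by simp

definition eval :: "('a \<Rightarrow> 'b) \<Rightarrow> ('a word \<Rightarrow>\<^sub>0 complex) \<Rightarrow> 'b"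
  where "eval g f =
    (\<Sum>w\<in>Poly_Mapping.keys f. e (Poly_Mapping.lookup f w) * prod_list (map g (letters w)))"

lemma eval_superset:
  assumes "finite S" "Poly_Mapping.keys f \<subseteq> S"
  shows "eval g f = (\<Sum>w\<in>S. e (Poly_Mapping.lookup f w) * prod_list (map g (letters w)))"
  unfolding eval_def using assms
  by (intro sum.mono_neutral_left) (auto simp: in_keys_iff e_zero)

lemma eval_single: "eval g (Poly_Mapping.single w c) = e c * prod_list (map g (letters w))"
  by (subst eval_superset[of "{w}"]) (auto simp: e_zero)

lemma eval_zero [simp]: "eval g 0 = 0"
  by (simp add: eval_def)

lemma eval_add: "eval g (f1 + f2) = eval g f1 + eval g f2"
proof -
  let ?S = "Poly_Mapping.keys f1 \<union> Poly_Mapping.keys f2"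
  have "eval g f = (\<Sum>w\<in>?S. e (Poly_Mapping.lookup f w) * prod_list (map g (letters w)))"
    if "f \<in> {f1, f2, f1 + f2}" for f
    using that Poly_Mapping.keys_add[of f1 f2] by (intro eval_superset) auto
  then show ?thesis
    by (simp add: lookup_add e_add distrib_right sum.distrib)
qed

lemma eval_sum: "eval g (\<Sum>i\<in>S. f i) = (\<Sum>i\<in>S. eval g (f i))"
  by (induction S rule: infinite_finite_induct) (simp_all add: eval_add)

lemma eval_mult: "eval g (f1 * f2) = eval g f1 * eval g f2"
proof -
  let ?l = Poly_Mapping.lookup and ?s = Poly_Mapping.single
  let ?P = "\<lambda>w. prod_list (map g (letters w))"
  have "f1 * f2 = (\<Sum>u\<in>Poly_Mapping.keys f1. ?s u (?l f1 u)) * (\<Sum>v\<in>Poly_Mapping.keys f2. ?s v (?l f2 v))"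
    by (simp only: poly_mapping_sum_monomials)
  also have "\<dots> = (\<Sum>u\<in>Poly_Mapping.keys f1. \<Sum>v\<in>Poly_Mapping.keys f2. ?s (u + v) (?l f1 u * ?l f2 v))"
    by (simp add: sum_product mult_single)
  finally have "eval g (f1 * f2) = (\<Sum>u\<in>Poly_Mapping.keys f1. \<Sum>v\<in>Poly_Mapping.keys f2.
      e (?l f1 u * ?l f2 v) * ?P (u + v))"
    by (simp add: eval_sum eval_single)
  also have "\<dots> = (\<Sum>u\<in>Poly_Mapping.keys f1. \<Sum>v\<in>Poly_Mapping.keys f2.
      (e (?l f1 u) * ?P u) * (e (?l f2 v) * ?P v))"
  proof (intro sum.cong refl)
    fix u v
    have "e (?l f1 u * ?l f2 v) * ?P (u + v) = e (?l f1 u) * (e (?l f2 v) * ?P u) * ?P v"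
      by (simp add: e_mult mult.assoc)
    then show "e (?l f1 u * ?l f2 v) * ?P (u + v) = (e (?l f1 u) * ?P u) * (e (?l f2 v) * ?P v)"
      by (simp only: e_central[of "?l f2 v" "?P u"] mult.assoc)
  qed
  finally show ?thesis
    by (simp add: eval_def sum_product)
qed

lemma eval_one [simp]: "eval g 1 = 1"
  using eval_single[of g 0 1] by (simp add: e_one)

lemma eval_scal: "eval g (scal c f) = e c * eval g f"
  by (simp add: scal_conv_mult eval_mult eval_single)

lemma eval_var [simp]: "eval g (var a) = g a"
  by (simp add: var_def eval_single e_one)

lemma eval_diff: "eval g (f1 - f2) = eval g f1 - eval g f2"
  using eval_add[of g "f1 - f2" f2] by simp

lemma eval_cong:
  assumes "f \<in> carrier (free_algebra X)" "\<And>a. a \<in> X \<Longrightarrow> g a = g' a"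
  shows "eval g f = eval g' f"
  unfolding eval_def
proof (rule sum.cong)
  fix w assume "w \<in> Poly_Mapping.keys f"
  with assms have "map g (letters w) = map g' (letters w)"
    by (auto simp: free_algebra_def)
  then show "e (Poly_Mapping.lookup f w) * prod_list (map g (letters w)) =
      e (Poly_Mapping.lookup f w) * prod_list (map g' (letters w))" by (simp only:)
qed simp

end

interpretation scalar: scalar_embedding "\<lambda>c. c :: complex"
  by standard (simp_all add: mult.commute)

interpretation subst: scalar_embedding "Poly_Mapping.single 0 :: complex \<Rightarrow> 'a word \<Rightarrow>\<^sub>0 complex"
proof
  fix c and x :: "'a word \<Rightarrow>\<^sub>0 complex"
  let ?l = "Poly_Mapping.lookup x" and ?c = "Poly_Mapping.single 0 c :: 'a word \<Rightarrow>\<^sub>0 complex"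
  have "?c * x = (\<Sum>w\<in>Poly_Mapping.keys x. ?c * Poly_Mapping.single w (?l w))"
    by (simp only: sum_distrib_left[symmetric] poly_mapping_sum_monomials)
  also have "\<dots> = (\<Sum>w\<in>Poly_Mapping.keys x. Poly_Mapping.single w (?l w) * ?c)"
    by (simp add: mult_single mult.commute)
  also have "\<dots> = x * Poly_Mapping.single 0 c"
    by (simp only: sum_distrib_right[symmetric] poly_mapping_sum_monomials)
  finally show "Poly_Mapping.single 0 c * x = x * Poly_Mapping.single 0 c" .
qed (simp_all add: single_add mult_single)

section \<open>The free algebra as a carrier set\<close>

lemma free_algebra_simps [simp]:
  "x \<otimes>\<^bsub>free_algebra X\<^esub> y = x * y" "x \<oplus>\<^bsub>free_algebra X\<^esub> y = x + y"
  "\<one>\<^bsub>free_algebra X\<^esub> = 1" "\<zero>\<^bsub>free_algebra X\<^esub> = 0" "c \<odot>\<^bsub>free_algebra X\<^esub> x = scal c x"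
  by (simp_all add: free_algebra_def)

lemma mem_free_algebra:
  "f \<in> carrier (free_algebra X) \<longleftrightarrow> (\<forall>w\<in>Poly_Mapping.keys f. set (letters w) \<subseteq> X)"
  by (simp add: free_algebra_def)

lemma single_in_free_algebra [simp]: "Poly_Mapping.single 0 c \<in> carrier (free_algebra X)"
  by (simp add: mem_free_algebra)

lemma one_in_free_algebra [simp]: "1 \<in> carrier (free_algebra X)"
  using single_in_free_algebra[of 1 X] by simp

lemma var_in_free_algebra [simp]: "a \<in> X \<Longrightarrow> var a \<in> carrier (free_algebra X)"
  by (simp add: free_algebra_def var_def)

lemma free_algebra_mult:
  "f \<in> carrier (free_algebra X) \<Longrightarrow> g \<in> carrier (free_algebra X) \<Longrightarrow> f * g \<in> carrier (free_algebra X)"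
  using monoid.m_closed[OF ring.is_monoid[OF ring_free_algebra], of f X g] by simp

lemma free_algebra_add:
  "f \<in> carrier (free_algebra X) \<Longrightarrow> g \<in> carrier (free_algebra X) \<Longrightarrow> f + g \<in> carrier (free_algebra X)"
  using abelian_monoid.a_closed[OF abelian_group.axioms(1)[OF ring.is_abelian_group[OF ring_free_algebra]], of f X g]
  by simp

lemma free_algebra_uminus: "f \<in> carrier (free_algebra X) \<Longrightarrow> - f \<in> carrier (free_algebra X)"
  by (simp add: mem_free_algebra)

lemma free_algebra_diff:
  "f \<in> carrier (free_algebra X) \<Longrightarrow> g \<in> carrier (free_algebra X) \<Longrightarrow> f - g \<in> carrier (free_algebra X)"
  using free_algebra_add[OF _ free_algebra_uminus] by fastforce

lemma free_algebra_scal: "f \<in> carrier (free_algebra X) \<Longrightarrow> scal c f \<in> carrier (free_algebra X)"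
  by (simp add: scal_conv_mult free_algebra_mult)

lemmas free_algebra_closed [intro] = free_algebra_mult free_algebra_add free_algebra_uminus
  free_algebra_diff free_algebra_scal

lemma free_algebra_sum_closed:
  assumes "\<And>i. i \<in> S \<Longrightarrow> f i \<in> carrier (free_algebra X)"
  shows "(\<Sum>i\<in>S. f i) \<in> carrier (free_algebra X)"
  using assms
proof (induction S rule: infinite_finite_induct)
  case (insert i S)
  then show ?case by (auto intro: free_algebra_add)
qed (simp_all add: free_algebra_def)

lemma subst_closed:
  assumes "\<And>a. a \<in> X \<Longrightarrow> g a \<in> carrier (free_algebra Y)" "f \<in> carrier (free_algebra X)"
  shows "subst.eval g f \<in> carrier (free_algebra Y)"
  unfolding subst.eval_def
proof (intro free_algebra_sum_closed free_algebra_mult single_in_free_algebra)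
  fix w assume "w \<in> Poly_Mapping.keys f"
  then have "set (letters w) \<subseteq> X" using assms(2) by (auto simp: free_algebra_def)
  moreover have "prod_list (map g l) \<in> carrier (free_algebra Y)" if "set l \<subseteq> X" for l
    using that by (induction l) (auto intro!: free_algebra_closed assms(1))
  ultimately show "prod_list (map g (letters w)) \<in> carrier (free_algebra Y)" by simp
qed

lemma subst_var:
  fixes f :: "'a word \<Rightarrow>\<^sub>0 complex"
  shows "subst.eval var f = f"
proof -
  have unit: "Poly_Mapping.single (Word [] :: 'a word) (1 :: complex) = 1"
    by (metis single_one zero_word_def)
  have "prod_list (map var l) = Poly_Mapping.single (Word l) 1" for l :: "'a list"
    by (induction l) (simp_all add: var_def mult_single plus_word_def unit)
  then have "subst.eval var f = (\<Sum>w\<in>Poly_Mapping.keys f. Poly_Mapping.single w (Poly_Mapping.lookup f w))"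
    by (simp add: subst.eval_def mult_single)
  then show ?thesis by (simp add: poly_mapping_sum_monomials)
qed

lemma subst_subst: "subst.eval g (subst.eval h f) = subst.eval (\<lambda>a. subst.eval g (h a)) f"
proof -
  have "subst.eval g (prod_list (map h l)) = prod_list (map (\<lambda>a. subst.eval g (h a)) l)" for l
    by (induction l) (simp_all add: subst.eval_mult)
  then show ?thesis
    unfolding subst.eval_def[of h] subst.eval_def[of "\<lambda>a. subst.eval g (h a)"]
    by (simp add: subst.eval_sum subst.eval_mult subst.eval_single)
qed

section \<open>Quotients of free algebras\<close>

lemma uminus_free_algebra:
  assumes "f \<in> carrier (free_algebra X)"
  shows "\<ominus>\<^bsub>free_algebra X\<^esub> f = - f"
proof -
  interpret ring "free_algebra X" by (rule ring_free_algebra)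
  have "- f \<in> carrier (free_algebra X)"
    using assms by (simp add: mem_free_algebra)
  then show ?thesis
    using assms minus_equality[of "- f" f] by simp
qed

context
  fixes X :: "'a set" and I
  assumes I: "ideal I (free_algebra X)"
begin

interpretation ideal I "free_algebra X" by (rule I)

lemma ideal_carrier: "f \<in> I \<Longrightarrow> f \<in> carrier (free_algebra X)"
  using a_subset by blast

lemma ideal_zero: "0 \<in> I"
  using additive_subgroup.zero_closed[OF additive_subgroup_axioms] by simp

lemma ideal_add: "f \<in> I \<Longrightarrow> g \<in> I \<Longrightarrow> f + g \<in> I"
  using additive_subgroup.a_closed[OF additive_subgroup_axioms, of f g] by simp

lemma ideal_scal: "f \<in> I \<Longrightarrow> scal c f \<in> I"
  using I_l_closed[of f "Poly_Mapping.single 0 c"] by (simp add: scal_conv_mult)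

lemma ideal_diff: "f \<in> I \<Longrightarrow> g \<in> I \<Longrightarrow> f - g \<in> I"
proof -
  assume "f \<in> I" "g \<in> I"
  then have "f + scal (- 1) g \<in> I" by (intro ideal_add ideal_scal)
  moreover have "scal (- 1) g = - g" by (rule poly_mapping_eqI) simp
  ultimately show ?thesis by simp
qed

lemma ideal_sum: "(\<And>i. i \<in> S \<Longrightarrow> f i \<in> I) \<Longrightarrow> (\<Sum>i\<in>S. f i) \<in> I"
  by (induction S rule: infinite_finite_induct) (auto simp: ideal_zero intro: ideal_add)

lemma coset_eq_iff:
  assumes "f \<in> carrier (free_algebra X)" "g \<in> carrier (free_algebra X)"
  shows "I +>\<^bsub>free_algebra X\<^esub> f = I +>\<^bsub>free_algebra X\<^esub> g \<longleftrightarrow> f - g \<in> I"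
  using quotient_eq_iff_same_a_r_cos[OF I assms] assms
  by (simp add: a_minus_def uminus_free_algebra)

lemma quot_carrier:
  "carrier (free_algebra X AlgQuot I) = (\<lambda>f. I +>\<^bsub>free_algebra X\<^esub> f) ` carrier (free_algebra X)"
  by (auto simp: quot_algebra_def ring.defs FactRing_def A_RCOSETS_def' a_r_coset_def')

lemma quot_one: "\<one>\<^bsub>free_algebra X AlgQuot I\<^esub> = I +>\<^bsub>free_algebra X\<^esub> 1"
  by (simp add: quot_algebra_def ring.defs FactRing_def)

lemma quot_mult:
  assumes "f \<in> carrier (free_algebra X)" "g \<in> carrier (free_algebra X)"
  shows "(I +>\<^bsub>free_algebra X\<^esub> f) \<otimes>\<^bsub>free_algebra X AlgQuot I\<^esub> (I +>\<^bsub>free_algebra X\<^esub> g) =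
    I +>\<^bsub>free_algebra X\<^esub> (f * g)"
  using rcoset_mult_add[OF assms] by (simp add: quot_algebra_def ring.defs FactRing_def)

lemma quot_add:
  assumes "f \<in> carrier (free_algebra X)" "g \<in> carrier (free_algebra X)"
  shows "(I +>\<^bsub>free_algebra X\<^esub> f) \<oplus>\<^bsub>free_algebra X AlgQuot I\<^esub> (I +>\<^bsub>free_algebra X\<^esub> g) =
    I +>\<^bsub>free_algebra X\<^esub> (f + g)"
  using a_rcos_sum[OF assms] by (simp add: quot_algebra_def ring.defs FactRing_def)

text \<open>Scalar multiplication in the quotient is a union over all representatives. They contribute the
same coset because a two-sided ideal absorbs the scalars, which are elements of the algebra.\<close>

lemma quot_smult:
  assumes "f \<in> carrier (free_algebra X)"
  shows "c \<odot>\<^bsub>free_algebra X AlgQuot I\<^esub> (I +>\<^bsub>free_algebra X\<^esub> f) = I +>\<^bsub>free_algebra X\<^esub> (scal c f)"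
proof -
  have "I +>\<^bsub>free_algebra X\<^esub> (scal c g) = I +>\<^bsub>free_algebra X\<^esub> (scal c f)"
    if "g \<in> I +>\<^bsub>free_algebra X\<^esub> f" for g
  proof -
    from that obtain i where i: "i \<in> I" "g = i + f"
      by (auto simp: a_r_coset_def')
    then have "scal c g - scal c f \<in> I"
      using ideal_scal[of i c] by (simp flip: scal_diff)
    then show ?thesis
      using i(2) assms ideal_carrier[OF i(1)] by (subst coset_eq_iff) auto
  qed
  moreover have "f \<in> I +>\<^bsub>free_algebra X\<^esub> f"
    using a_rcos_self[OF assms] .
  ultimately have "(\<Union>g\<in>I +>\<^bsub>free_algebra X\<^esub> f. I +>\<^bsub>free_algebra X\<^esub> (scal c g)) =
      I +>\<^bsub>free_algebra X\<^esub> (scal c f)"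
    by blast
  then show ?thesis
    by (simp add: quot_algebra_def ring.defs module.defs)
qed

text \<open>Maps out of the quotient are obtained by choosing representatives; this turns maps that respect
the ideal into maps on cosets.\<close>

lemma quot_lift:
  assumes "\<And>f g. f \<in> carrier (free_algebra X) \<Longrightarrow> g \<in> carrier (free_algebra X) \<Longrightarrow>
    f - g \<in> I \<Longrightarrow> \<Phi> f = \<Phi> g"
  obtains H where "\<And>f. f \<in> carrier (free_algebra X) \<Longrightarrow> H (I +>\<^bsub>free_algebra X\<^esub> f) = \<Phi> f"
proof
  let ?rep = "\<lambda>Z. SOME g. g \<in> carrier (free_algebra X) \<and> Z = I +>\<^bsub>free_algebra X\<^esub> g"
  fix f assume f: "f \<in> carrier (free_algebra X)"
  then have "?rep (I +>\<^bsub>free_algebra X\<^esub> f) \<in> carrier (free_algebra X) \<and>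
      I +>\<^bsub>free_algebra X\<^esub> f = I +>\<^bsub>free_algebra X\<^esub> ?rep (I +>\<^bsub>free_algebra X\<^esub> f)"
    by (intro someI) auto
  then show "\<Phi> (?rep (I +>\<^bsub>free_algebra X\<^esub> f)) = \<Phi> f"
    using f by (intro assms) (auto simp: coset_eq_iff[OF _ f, symmetric])
qed

end

lemma subst_scal: "subst.eval g (scal c f) = scal c (subst.eval g f)"
  by (simp only: subst.eval_scal scal_conv_mult[symmetric])

section \<open>Isomorphisms given by substitutions\<close>

lemma ideal_vimage_subst:
  assumes g: "\<And>a. a \<in> X \<Longrightarrow> g a \<in> carrier (free_algebra Y)" and J: "ideal J (free_algebra Y)"
  shows "ideal {f \<in> carrier (free_algebra X). subst.eval g f \<in> J} (free_algebra X)"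
proof (rule ring_hom_ring.ideal_vimage[OF _ J])
  show "ring_hom_ring (free_algebra X) (free_algebra Y) (subst.eval g)"
  proof (rule ring_hom_ringI2)
    show "subst.eval g \<in> ring_hom (free_algebra X) (free_algebra Y)"
      by (rule ring_hom_memI) (simp_all add: subst_closed[OF g] subst.eval_add subst.eval_mult)
  qed (rule ring_free_algebra)+
qed

text \<open>The substitution \<open>g\<close> pulls the ideal of \<open>S\<close> back to an ideal; as soon as that contains \<open>R\<close>, it
contains the whole ideal generated by \<open>R\<close>. By symmetry the mutually inverse substitutions carry
the two ideals onto each other, so they descend to the quotients. It therefore suffices to test
generators and defining relations.\<close>

lemma presentation_iso:
  fixes X :: "'a set" and Y :: "'b set"
  assumes R: "R \<subseteq> carrier (free_algebra X)" and S: "S \<subseteq> carrier (free_algebra Y)"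
    and g: "\<And>a. a \<in> X \<Longrightarrow> g a \<in> carrier (free_algebra Y)"
    and h: "\<And>b. b \<in> Y \<Longrightarrow> h b \<in> carrier (free_algebra X)"
    and hg: "\<And>a. a \<in> X \<Longrightarrow> subst.eval h (g a) = var a"
    and gh: "\<And>b. b \<in> Y \<Longrightarrow> subst.eval g (h b) = var b"
    and gR: "\<And>r. r \<in> R \<Longrightarrow> subst.eval g r \<in> Idl\<^bsub>free_algebra Y\<^esub> S"
    and hS: "\<And>s. s \<in> S \<Longrightarrow> subst.eval h s \<in> Idl\<^bsub>free_algebra X\<^esub> R"
  shows "free_algebra X AlgQuot (Idl\<^bsub>free_algebra X\<^esub> R) \<simeq>\<^sub>a\<^sub>l\<^sub>g
    free_algebra Y AlgQuot (Idl\<^bsub>free_algebra Y\<^esub> S)"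
proof -
  let ?F = "free_algebra X" and ?G = "free_algebra Y"
  define I where "I = Idl\<^bsub>?F\<^esub> R"
  define J where "J = Idl\<^bsub>?G\<^esub> S"
  note ringF = ring_free_algebra[of X] and ringG = ring_free_algebra[of Y]
  have I: "ideal I ?F" and J: "ideal J ?G"
    unfolding I_def J_def using ring.genideal_ideal[OF ringF R] ring.genideal_ideal[OF ringG S] by auto
  have IJ: "subst.eval g f \<in> J" if "f \<in> I" for f
  proof -
    have "I \<subseteq> {f \<in> carrier ?F. subst.eval g f \<in> J}"
      unfolding I_def using R gR
      by (intro ring.genideal_minimal[OF ringF ideal_vimage_subst[OF g J]]) (auto simp: J_def)
    with that show ?thesis by blast
  qed
  have JI: "subst.eval h f \<in> I" if "f \<in> J" for f
  proof -
    have "J \<subseteq> {f \<in> carrier ?G. subst.eval h f \<in> I}"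
      unfolding J_def using S hS
      by (intro ring.genideal_minimal[OF ringG ideal_vimage_subst[OF h I]]) (auto simp: I_def)
    with that show ?thesis by blast
  qed
  have gc: "subst.eval g f \<in> carrier ?G" if "f \<in> carrier ?F" for f
    using subst_closed[OF g that] .
  have hc: "subst.eval h f \<in> carrier ?F" if "f \<in> carrier ?G" for f
    using subst_closed[OF h that] .
  have hg_id: "subst.eval h (subst.eval g f) = f" if "f \<in> carrier ?F" for f
    unfolding subst_subst using subst.eval_cong[OF that hg] by (simp add: subst_var)
  have gh_id: "subst.eval g (subst.eval h f) = f" if "f \<in> carrier ?G" for f
    unfolding subst_subst using subst.eval_cong[OF that gh] by (simp add: subst_var)
  obtain H where H: "\<And>f. f \<in> carrier ?F \<Longrightarrow> H (I +>\<^bsub>?F\<^esub> f) = J +>\<^bsub>?G\<^esub> subst.eval g f"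
  proof (rule quot_lift[OF I])
    fix f f' assume f: "f \<in> carrier ?F" "f' \<in> carrier ?F" "f - f' \<in> I"
    from IJ[OF f(3)] show "J +>\<^bsub>?G\<^esub> subst.eval g f = J +>\<^bsub>?G\<^esub> subst.eval g f'"
      by (subst coset_eq_iff[OF J gc gc]) (use f in \<open>simp_all add: subst.eval_diff\<close>)
  qed blast
  have "H \<in> ring_iso (?F AlgQuot I) (?G AlgQuot J)"
  proof (rule ring_iso_memI)
    show "bij_betw H (carrier (?F AlgQuot I)) (carrier (?G AlgQuot J))"
    proof (rule bij_betw_imageI)
      show "inj_on H (carrier (?F AlgQuot I))"
      proof (rule inj_onI)
        fix Z Z' assume "Z \<in> carrier (?F AlgQuot I)" "Z' \<in> carrier (?F AlgQuot I)" and eq: "H Z = H Z'"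
        then obtain f f' where f: "f \<in> carrier ?F" "f' \<in> carrier ?F"
            and Z: "Z = I +>\<^bsub>?F\<^esub> f" "Z' = I +>\<^bsub>?F\<^esub> f'"
          by (auto simp: quot_carrier[OF I])
        from eq have "subst.eval g (f - f') \<in> J"
          unfolding Z H[OF f(1)] H[OF f(2)] coset_eq_iff[OF J gc[OF f(1)] gc[OF f(2)]]
          by (simp add: subst.eval_diff)
        then have "subst.eval h (subst.eval g (f - f')) \<in> I" by (rule JI)
        then have "f - f' \<in> I" using f by (subst (asm) hg_id) auto
        then show "Z = Z'" unfolding Z by (simp add: coset_eq_iff[OF I f])
      qed
      show "H ` carrier (?F AlgQuot I) = carrier (?G AlgQuot J)"
      proof -
        have "subst.eval g ` carrier ?F = carrier ?G"
          using gc hc gh_id by (force simp: image_iff)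
        then have "(\<lambda>f. J +>\<^bsub>?G\<^esub> f) ` subst.eval g ` carrier ?F = carrier (?G AlgQuot J)"
          by (simp add: quot_carrier[OF J])
        then show ?thesis
          by (simp add: quot_carrier[OF I] image_image H)
      qed
    qed
  qed (auto simp: quot_carrier[OF I] quot_carrier[OF J] quot_mult[OF I] quot_mult[OF J]
      quot_add[OF I] quot_add[OF J] quot_one[OF I] quot_one[OF J] H gc free_algebra_closed
      subst.eval_mult subst.eval_add)
  moreover have "H (c \<odot>\<^bsub>?F AlgQuot I\<^esub> Z) = c \<odot>\<^bsub>?G AlgQuot J\<^esub> H Z" if "Z \<in> carrier (?F AlgQuot I)" for c Z
  proof -
    from that obtain f where f: "f \<in> carrier ?F" "Z = I +>\<^bsub>?F\<^esub> f"
      by (auto simp: quot_carrier[OF I])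
    then show ?thesis
      using gc[OF f(1)] free_algebra_scal[OF f(1), of c]
      by (simp add: quot_smult[OF I] quot_smult[OF J] H subst_scal)
  qed
  ultimately show ?thesis
    unfolding algebra_isomorphic_def I_def J_def by blast
qed

section \<open>Characters are common zeros of the relations\<close>

definition character :: "(complex, 'b) module \<Rightarrow> ('b \<Rightarrow> complex) \<Rightarrow> bool"
  where "character A \<chi> \<longleftrightarrow> \<chi> \<in> ring_hom A complex_field \<and>
    (\<forall>c. \<forall>x\<in>carrier A. \<chi> (c \<odot>\<^bsub>A\<^esub> x) = c * \<chi> x)"

lemma character_comp_iso:
  assumes "h \<in> ring_iso A B" "\<And>c x. x \<in> carrier A \<Longrightarrow> h (c \<odot>\<^bsub>A\<^esub> x) = c \<odot>\<^bsub>B\<^esub> h x"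
    and "character B \<chi>"
  shows "character A (\<chi> \<circ> h)"
proof -
  have h: "h \<in> ring_hom A B" using assms(1) by (simp add: ring_iso_def)
  then have "\<chi> \<circ> h \<in> ring_hom A complex_field"
    using assms(3) ring_hom_trans[of h A B \<chi> complex_field] by (simp add: character_def)
  moreover have "h x \<in> carrier B" if "x \<in> carrier A" for x
    using h that by (rule ring_hom_closed)
  ultimately show ?thesis
    using assms(2,3) by (simp add: character_def)
qed

text \<open>Evaluation at \<open>\<mu>\<close> is multiplicative, so its kernel is an ideal; containing \<open>R\<close>, it contains the
ideal generated by \<open>R\<close>.\<close>

lemma character_of_point:
  assumes R: "R \<subseteq> carrier (free_algebra X)" and zero: "\<And>r. r \<in> R \<Longrightarrow> scalar.eval \<mu> r = 0"
  obtains \<chi> where "character (free_algebra X AlgQuot (Idl\<^bsub>free_algebra X\<^esub> R)) \<chi>"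
    "\<And>f. f \<in> carrier (free_algebra X) \<Longrightarrow>
      \<chi> (Idl\<^bsub>free_algebra X\<^esub> R +>\<^bsub>free_algebra X\<^esub> f) = scalar.eval \<mu> f"
proof -
  let ?F = "free_algebra X"
  define I where "I = Idl\<^bsub>?F\<^esub> R"
  note ringF = ring_free_algebra[of X]
  have I: "ideal I ?F"
    unfolding I_def by (rule ring.genideal_ideal[OF ringF R])
  have vanish: "scalar.eval \<mu> f = 0" if "f \<in> I" for f
  proof -
    have "ideal {f \<in> carrier ?F. scalar.eval \<mu> f = 0} ?F"
    proof (rule idealI[OF ringF])
      interpret ring ?F by (rule ringF)
      let ?K = "{f \<in> carrier ?F. scalar.eval \<mu> f = 0}"
      show "subgroup ?K (add_monoid ?F)"
      proof (rule add.subgroupI)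
        show "?K \<noteq> {}" using zero_closed by auto
        show "\<ominus>\<^bsub>?F\<^esub> f \<in> ?K" if "f \<in> ?K" for f
          using that scalar.eval_diff[of \<mu> 0 f]
          by (auto simp: uminus_free_algebra free_algebra_uminus)
      qed (auto simp: scalar.eval_add)
    qed (auto simp: scalar.eval_mult)
    then have "I \<subseteq> {f \<in> carrier ?F. scalar.eval \<mu> f = 0}"
      unfolding I_def using R zero by (intro ring.genideal_minimal[OF ringF]) auto
    with that show ?thesis by blast
  qed
  obtain \<chi> where \<chi>: "\<And>f. f \<in> carrier ?F \<Longrightarrow> \<chi> (I +>\<^bsub>?F\<^esub> f) = scalar.eval \<mu> f"
  proof (rule quot_lift[OF I])
    fix f f' assume "f - f' \<in> I"
    then show "scalar.eval \<mu> f = scalar.eval \<mu> f'"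
      using vanish[of "f - f'"] by (simp add: scalar.eval_diff)
  qed blast
  have "\<chi> \<in> ring_hom (?F AlgQuot I) complex_field"
    by (rule ring_hom_memI)
       (auto simp: complex_field_def quot_carrier[OF I] quot_mult[OF I] quot_add[OF I] quot_one[OF I]
         \<chi> free_algebra_closed scalar.eval_mult scalar.eval_add)
  moreover have "\<chi> (c \<odot>\<^bsub>?F AlgQuot I\<^esub> Z) = c * \<chi> Z" if "Z \<in> carrier (?F AlgQuot I)" for c Z
  proof -
    from that obtain f where f: "f \<in> carrier ?F" "Z = I +>\<^bsub>?F\<^esub> f"
      by (auto simp: quot_carrier[OF I])
    then show ?thesis
      using free_algebra_scal[OF f(1), of c]
      by (simp add: quot_smult[OF I] \<chi> scalar.eval_scal)
  qed
  ultimately have "character (?F AlgQuot I) \<chi>"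
    by (simp add: character_def)
  with \<chi> that show ?thesis unfolding I_def by blast
qed

text \<open>The converse: the coordinates of the point are the values of \<open>\<chi>\<close> on the generators, and
multiplicativity extends this from the generators to words and, by linearity, to all elements.\<close>

lemma point_of_character:
  assumes R: "R \<subseteq> carrier (free_algebra X)"
    and \<chi>: "character (free_algebra X AlgQuot (Idl\<^bsub>free_algebra X\<^esub> R)) \<chi>"
  obtains \<mu> where
    "\<And>f. f \<in> carrier (free_algebra X) \<Longrightarrow>
      \<chi> (Idl\<^bsub>free_algebra X\<^esub> R +>\<^bsub>free_algebra X\<^esub> f) = scalar.eval \<mu> f"
    "\<And>r. r \<in> R \<Longrightarrow> scalar.eval \<mu> r = 0"
proof
  let ?F = "free_algebra X"
  define I where "I = Idl\<^bsub>?F\<^esub> R"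
  note ringF = ring_free_algebra[of X]
  interpret ring ?F by (rule ringF)
  have I: "ideal I ?F"
    unfolding I_def by (rule genideal_ideal[OF R])
  define \<psi> where "\<psi> f = \<chi> (I +>\<^bsub>?F\<^esub> f)" for f
  define \<mu> where "\<mu> a = \<psi> (var a)" for a
  have hom: "\<chi> \<in> ring_hom (?F AlgQuot I) complex_field"
    using \<chi> by (simp add: character_def I_def)
  have coset: "I +>\<^bsub>?F\<^esub> f \<in> carrier (?F AlgQuot I)" if "f \<in> carrier ?F" for f
    using that by (auto simp: quot_carrier[OF I])
  have mult: "\<psi> (f * g) = \<psi> f * \<psi> g" if "f \<in> carrier ?F" "g \<in> carrier ?F" for f g
    using ring_hom_mult[OF hom coset[OF that(1)] coset[OF that(2)]]
    by (simp add: quot_mult[OF I that] \<psi>_def complex_field_def)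
  have add: "\<psi> (f + g) = \<psi> f + \<psi> g" if "f \<in> carrier ?F" "g \<in> carrier ?F" for f g
    using ring_hom_add[OF hom coset[OF that(1)] coset[OF that(2)]]
    by (simp add: quot_add[OF I that] \<psi>_def complex_field_def)
  have one: "\<psi> 1 = 1"
    using ring_hom_one[OF hom] by (simp add: quot_one[OF I] \<psi>_def complex_field_def)
  have scal: "\<psi> (scal c f) = c * \<psi> f" if "f \<in> carrier ?F" for c f
  proof -
    have "\<chi> (c \<odot>\<^bsub>?F AlgQuot I\<^esub> (I +>\<^bsub>?F\<^esub> f)) = c * \<chi> (I +>\<^bsub>?F\<^esub> f)"
      using \<chi> coset[OF that] unfolding character_def I_def by blast
    then show ?thesis by (simp add: quot_smult[OF I that] \<psi>_def)
  qed
  have zero: "\<psi> 0 = 0"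
    using scal[of 1 0] by (simp add: scal_conv_mult)
  have monomial: "prod_list (map var l) \<in> carrier ?F \<and> \<psi> (prod_list (map var l)) = prod_list (map \<mu> l)"
    if "set l \<subseteq> X" for l
    using that by (induction l) (auto simp: one mult \<mu>_def free_algebra_closed)
  have eval: "\<psi> f = scalar.eval \<mu> f" if f: "f \<in> carrier ?F" for f
  proof -
    let ?t = "\<lambda>w. scal (Poly_Mapping.lookup f w) (prod_list (map var (letters w)))"
    have w: "set (letters w) \<subseteq> X" if "w \<in> Poly_Mapping.keys f" for w
      using f that by (simp add: mem_free_algebra)
    then have t: "?t w \<in> carrier ?F" if "w \<in> Poly_Mapping.keys f" for w
      using monomial that free_algebra_scal by blast
    have "(\<Sum>w\<in>S. ?t w) \<in> carrier ?F \<and> \<psi> (\<Sum>w\<in>S. ?t w) = (\<Sum>w\<in>S. \<psi> (?t w))"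
      if "finite S" "S \<subseteq> Poly_Mapping.keys f" for S
      using that
      by (induction S rule: finite_induct)
         (auto simp: zero add t free_algebra_closed mem_free_algebra[of 0])
    then have "\<psi> (\<Sum>w\<in>Poly_Mapping.keys f. ?t w) = (\<Sum>w\<in>Poly_Mapping.keys f. \<psi> (?t w))"
      by simp
    also have "\<dots> = scalar.eval \<mu> f"
      unfolding scalar.eval_def using monomial w by (intro sum.cong) (auto simp: scal)
    also have "(\<Sum>w\<in>Poly_Mapping.keys f. ?t w) = f"
      using subst_var[of f] by (simp add: subst.eval_def scal_conv_mult)
    finally show ?thesis .
  qed
  then show "\<chi> (Idl\<^bsub>?F\<^esub> R +>\<^bsub>?F\<^esub> f) = scalar.eval \<mu> f" if "f \<in> carrier ?F" for f
    using that unfolding \<psi>_def I_def by blast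
  show "scalar.eval \<mu> r = 0" if "r \<in> R" for r
  proof -
    have r: "r \<in> I" "r \<in> carrier ?F"
      using that R genideal_self[OF R] by (auto simp: I_def)
    then have "I +>\<^bsub>?F\<^esub> r = I +>\<^bsub>?F\<^esub> 0"
      by (subst coset_eq_iff[OF I]) (auto simp: mem_free_algebra)
    then have "\<psi> r = 0" using zero by (simp add: \<psi>_def)
    with eval[OF r(2)] show ?thesis by simp
  qed
qed

section \<open>Roots of unity and halves modulo an odd number\<close>

definition unity_root :: "nat \<Rightarrow> int \<Rightarrow> complex"
  where "unity_root p n = cis (2 * pi * of_int n / of_nat p)"

lemma unity_root_0 [simp]: "unity_root p 0 = 1"
  by (simp add: unity_root_def)

lemma unity_root_nonzero [simp]: "unity_root p n \<noteq> 0"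
  by (simp add: unity_root_def)

lemma unity_root_add: "unity_root p (m + n) = unity_root p m * unity_root p n"
  by (simp add: unity_root_def cis_mult add_divide_distrib distrib_left)

lemma unity_root_power: "unity_root p n ^ k = unity_root p (n * int k)"
  by (induction k) (simp_all add: unity_root_add[symmetric] algebra_simps)

context
  fixes p :: nat
  assumes p: "p > 0"
begin

lemma unity_root_multiple: "unity_root p (int p * n) = 1"
proof -
  have "2 * pi * of_int (int p * n) / of_nat p = 2 * pi * of_int n"
    using p by simp
  then show ?thesis
    unfolding unity_root_def by (simp only: cis_multiple_2pi Ints_of_int)
qed

lemma unity_root_cong:
  assumes "[m = n] (mod int p)"
  shows "unity_root p m = unity_root p n"
proof -
  from assms obtain k where "m = n + int p * k"
    by (metis cong_iff_lin cong_sym)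
  then show ?thesis
    by (simp add: unity_root_add unity_root_multiple)
qed

lemma unity_root_eq_1_iff: "unity_root p n = 1 \<longleftrightarrow> [n = 0] (mod int p)"
proof
  assume *: "unity_root p n = 1"
  let ?k = "nat (n mod int p)"
  have "?k < p" using p by (simp add: nat_less_iff)
  have "unity_root p n = unity_root p (int ?k)"
    using p by (intro unity_root_cong) (simp add: Cong.cong_def)
  then have "cis (2 * pi * real ?k / real p) = cis (2 * pi * real 0 / real p)"
    using * unfolding unity_root_def by (simp only: of_int_of_nat_eq) simp
  moreover have "inj_on (\<lambda>k. cis (2 * pi * real k / real p)) {..<p}"
    using bij_betw_roots_unity[OF p] by (rule bij_betw_imp_inj_on)
  ultimately have "?k = 0"
    using \<open>?k < p\<close> p unfolding inj_on_def by blast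
  moreover have "n mod int p \<ge> 0"
    using p by simp
  ultimately have "n mod int p = 0" by linarith
  then show "[n = 0] (mod int p)" by (simp add: Cong.cong_def)
qed (use unity_root_cong[of n 0] in simp)

lemma unity_root_eq_iff: "unity_root p m = unity_root p n \<longleftrightarrow> [m = n] (mod int p)"
proof -
  have "unity_root p m = unity_root p (m - n) * unity_root p n"
    by (simp flip: unity_root_add)
  then have "unity_root p m = unity_root p n \<longleftrightarrow> unity_root p (m - n) = 1" by simp
  then show ?thesis
    by (simp add: unity_root_eq_1_iff cong_diff_iff_cong_0)
qed

lemma unity_root_surj:
  assumes "z ^ p = 1"
  obtains n where "z = unity_root p n"
proof -
  have "z \<in> (\<lambda>k. cis (2 * pi * real k / real p)) ` {..<p}"
    using bij_betw_imp_surj_on[OF bij_betw_roots_unity[OF p]] assms by auto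
  then obtain k :: nat where "z = cis (2 * pi * real k / real p)" by blast
  then show ?thesis using that[of "int k"] by (simp add: unity_root_def)
qed

lemma sum_unity_root:
  "(\<Sum>d\<in>{0..<int p}. unity_root p (k * d)) = (if [k = 0] (mod int p) then of_nat p else 0)"
proof -
  have "(\<Sum>d\<in>{0..<int p}. unity_root p (k * d)) = (\<Sum>d<p. unity_root p k ^ d)"
    by (rule sum.reindex_bij_witness[of _ int nat]) (auto simp: unity_root_power)
  also have "\<dots> = (if unity_root p k = 1 then of_nat p else 0)"
  proof -
    have "unity_root p k ^ p = 1"
      using unity_root_multiple[of k] by (simp add: unity_root_power mult.commute)
    then show ?thesis by (simp add: geometric_sum)
  qed
  finally show ?thesis by (simp add: unity_root_eq_1_iff)
qed

end

lemma cong_half: assumes "odd p" shows "[2 * half p i = int i] (mod int p)"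
proof -
  have "[int i * (2 * modular_inverse (int p) 2) = int i * 1] (mod int p)"
    using assms by (intro cong_mult cong_refl cong_modular_inverse1) simp
  then show ?thesis by (simp add: half_def algebra_simps)
qed

lemma cong_cancel_2: assumes "odd p" "[2 * m = 2 * n] (mod int p)" shows "[m = n] (mod int p)"
  using assms cong_mult_lcancel[of 2 "int p" m n] by simp

section \<open>Coefficients for which the Clifford relations have a nonzero zero\<close>

text \<open>The hypothesis \<open>p \<ge> 5\<close> makes \<open>2\<close> an admissible index, and \<open>a 2\<close> governs three
consecutive coordinates \<open>\<mu> m\<close>, \<open>\<mu> (m + 1)\<close>, \<open>\<mu> (m + 2)\<close>; this is what makes the ratios
of neighbours a geometric progression.\<close>

lemma coefficients_of_common_zero:
  fixes \<mu> :: "int \<Rightarrow> complex"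
  assumes p: "prime p" "p \<ge> 5"
    and per: "\<And>m n. [m = n] (mod int p) \<Longrightarrow> \<mu> m = \<mu> n"
    and rel: "\<And>j i. i \<in> {1..(p - 1) div 2} \<Longrightarrow>
      2 * a 0 * (\<mu> j * \<mu> (j + int i)) = a i * \<mu> (j + half p i) ^ 2"
    and \<mu>: "\<mu> j0 \<noteq> 0" and a: "i0 \<le> (p - 1) div 2" "a i0 \<noteq> 0"
  shows "a 0 \<noteq> 0 \<and> ((\<forall>i\<in>{1..(p - 1) div 2}. a i = 0) \<or>
    (\<exists>c\<in>{0..<int p}. \<forall>i\<in>{1..(p - 1) div 2}. a i = 2 * a 0 * unity_root p (c * int i ^ 2)))"
proof -
  let ?I = "{1..(p - 1) div 2}"
  have p0: "p > 0" and odd: "odd p" using p prime_odd_nat[of p] by auto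
  have a0: "a 0 \<noteq> 0"
  proof
    assume "a 0 = 0"
    with a have "i0 \<in> ?I" by (cases i0) auto
    (* The midpoint of this pair of indices is j0, so the relation says a i0 * mu j0 ^ 2 = 0. *)
    from rel[OF this, of "j0 - half p i0"] \<open>a 0 = 0\<close> a \<mu> show False by simp
  qed
  define b where "b i = a i / (2 * a 0)" for i
  have rel': "\<mu> j * \<mu> (j + int i) = b i * \<mu> (j + half p i) ^ 2" if "i \<in> ?I" for i j
    using rel[OF that, of j] a0 by (simp add: b_def field_simps)
  show ?thesis
  proof (cases "\<exists>i\<in>?I. a i \<noteq> 0")
    case True
    then obtain i1 where i1: "i1 \<in> ?I" "b i1 \<noteq> 0" using a0 by (auto simp: b_def)
    (* Nonvanishing spreads: if mu m is nonzero, so are both coordinates at distance i1/2 from m. *)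
    let ?h = "half p i1"
    have step: "\<mu> (m + ?h) \<noteq> 0" if "\<mu> m \<noteq> 0" for m
    proof -
      have "[m - ?h + int i1 = m - ?h + 2 * ?h] (mod int p)"
        by (intro cong_add cong_refl cong_sym[OF cong_half[OF odd]])
      then have "\<mu> (m - ?h + int i1) = \<mu> (m + ?h)" by (intro per) (simp add: add.commute)
      with rel'[OF i1(1), of "m - ?h"] i1(2) that show ?thesis by auto
    qed
    have steps: "\<mu> (j0 + int k * ?h) \<noteq> 0" for k
    proof (induction k)
      case (Suc k)
      from step[OF this] show ?case by (simp add: algebra_simps)
    qed (simp add: \<mu>)
    (* The step i1/2 generates the integers modulo p, so every index is reached from j0. *)
    have "\<not> int p dvd int i1"
      using i1(1) p by (auto dest!: dvd_imp_le)
    then have "\<not> int p dvd ?h"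
      using cong_half[OF odd, of i1] by (metis cong_dvd_iff dvd_mult)
    then have "coprime ?h (int p)"
      using p(1) by (simp add: prime_imp_coprime coprime_commute)
    then obtain x where x: "[?h * x = 1] (mod int p)"
      using cong_solve_coprime_int by blast
    have nz: "\<mu> m \<noteq> 0" for m
    proof -
      let ?k = "nat ((x * (m - j0)) mod int p)"
      have "[j0 + int ?k * ?h = j0 + (x * (m - j0)) * ?h] (mod int p)"
        using p0 by (intro cong_add cong_mult cong_refl) (simp add: Cong.cong_def)
      also have "j0 + (x * (m - j0)) * ?h = j0 + (?h * x) * (m - j0)"
        by (simp add: algebra_simps)
      also have "[\<dots> = j0 + 1 * (m - j0)] (mod int p)"
        by (intro cong_add cong_mult cong_refl x)
      finally have "\<mu> (j0 + int ?k * ?h) = \<mu> m" by (intro per) simp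
      with steps[of ?k] show ?thesis by simp
    qed
    define q where "q = b 2"
    have two: "2 \<in> ?I" using p by auto
    have half2: "[half p 2 = 1] (mod int p)"
      using cong_half[OF odd, of 2] cong_cancel_2[OF odd, of "half p 2" 1]
      by (simp only: of_nat_numeral mult_1_right)
    (* Neighbouring ratios: multiplied by q when the index grows by one. *)
    define \<rho> where "\<rho> m = \<mu> (m + 1) / \<mu> m" for m
    have \<rho>_nz: "\<rho> m \<noteq> 0" for m by (simp add: \<rho>_def nz)
    have \<rho>_step: "\<rho> (m + 1) = q * \<rho> m" for m
    proof -
      have "\<mu> (m + half p 2) = \<mu> (m + 1)"
        by (intro per cong_add cong_refl half2)
      with rel'[OF two, of m] nz[of m] nz[of "m + 1"] show ?thesis
        by (simp add: \<rho>_def q_def field_simps power2_eq_square)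
    qed
    have \<rho>_steps: "\<rho> (m + int k) = q ^ k * \<rho> m" for m k
    proof (induction k)
      case (Suc k)
      then show ?case using \<rho>_step[of "m + int k"] by (simp add: algebra_simps)
    qed simp
    (* Going once around the cycle multiplies the ratio by q ^ p. *)
    have "\<rho> (int p) = \<rho> 0"
      unfolding \<rho>_def by (intro arg_cong2[where f = "(/)"] per) (simp_all add: Cong.cong_def)
    then have "q ^ p = 1"
      using \<rho>_steps[of 0 p] \<rho>_nz[of 0] by simp
    then obtain t where t: "q = unity_root p t"
      using unity_root_surj[OF p0] by blast
    have gauss: "\<mu> (m - int d) * \<mu> (m + int d) = q ^ (d * d) * \<mu> m ^ 2" for m d
    proof (induction d)
      case (Suc d)
      let ?l = "m - int d - 1"
      have "\<mu> (m + int (Suc d)) = \<rho> (m + int d) * \<mu> (m + int d)"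
        using nz by (simp add: \<rho>_def algebra_simps)
      also have "\<rho> (m + int d) = q ^ (2 * d + 1) * \<rho> ?l"
        using \<rho>_steps[of ?l "2 * d + 1"] by (simp add: algebra_simps)
      finally have "\<mu> ?l * \<mu> (m + int (Suc d)) = q ^ (2 * d + 1) * ((\<rho> ?l * \<mu> ?l) * \<mu> (m + int d))"
        by simp
      also have "\<rho> ?l * \<mu> ?l = \<mu> (m - int d)"
        using nz by (simp add: \<rho>_def)
      also note Suc.IH
      finally show ?case by (simp add: power_add mult_2_right algebra_simps)
    qed (simp add: power2_eq_square)
    (* The exponent c is t/4 modulo p because the difference i of two indices is twice the offset d = i/2
       from their midpoint, and q is raised to the power d^2. *)
    have "coprime 4 (int p)"
      using odd coprime_power_left_iff[of "2 :: int" 2 "int p"] by simp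
    then obtain y where y: "[4 * y = 1] (mod int p)"
      using cong_solve_coprime_int by blast
    define c where "c = (t * y) mod int p"
    have c4: "[4 * c = t] (mod int p)"
    proof -
      have "[4 * c = 4 * (t * y)] (mod int p)"
        unfolding c_def by (intro cong_mult cong_refl) (simp add: Cong.cong_def)
      also have "4 * (t * y) = t * (4 * y)" by simp
      also have "[\<dots> = t * 1] (mod int p)" by (intro cong_mult cong_refl y)
      finally show ?thesis by simp
    qed
    have "a i = 2 * a 0 * unity_root p (c * int i ^ 2)" if i: "i \<in> ?I" for i
    proof -
      define d where "d = nat (half p i mod int p)"
      have d: "[int d = half p i] (mod int p)"
        using p0 by (simp add: d_def Cong.cong_def)
      then have d2: "[2 * int d = int i] (mod int p)"
        using cong_half[OF odd, of i] by (metis cong_mult cong_refl cong_trans)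
      have "b i * \<mu> (int d) ^ 2 = \<mu> 0 * \<mu> (2 * int d)"
        using rel'[OF i, of 0] per[OF d] per[OF d2] by simp
      also have "\<dots> = q ^ (d * d) * \<mu> (int d) ^ 2"
        using gauss[of "int d" d] by simp
      finally have "b i = q ^ (d * d)" using nz[of "int d"] by simp
      also have "\<dots> = unity_root p (t * int (d * d))"
        by (simp add: t unity_root_power)
      also have "\<dots> = unity_root p (c * int i ^ 2)"
      proof (rule unity_root_cong[OF p0])
        have "[t * int (d * d) = (4 * c) * int (d * d)] (mod int p)"
          by (intro cong_mult cong_refl cong_sym[OF c4])
        also have "(4 * c) * int (d * d) = c * (2 * int d) ^ 2"
          by (simp add: power2_eq_square)
        also have "[\<dots> = c * int i ^ 2] (mod int p)"
          by (intro cong_mult cong_pow cong_refl d2)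
        finally show "[t * int (d * d) = c * int i ^ 2] (mod int p)" .
      qed
      finally show ?thesis using a0 by (simp add: b_def field_simps)
    qed
    moreover have "c \<in> {0..<int p}" using p0 by (simp add: c_def)
    ultimately show ?thesis using a0 by blast
  qed (use a0 in blast)
qed

section \<open>Scalars and anticommutators\<close>

lemma scal_0 [simp]: "scal 0 f = 0"
  by (rule poly_mapping_eqI) simp

lemma scal_1 [simp]: "scal 1 f = f"
  by (rule poly_mapping_eqI) simp

lemma scal_zero [simp]: "scal c 0 = 0"
  by (rule poly_mapping_eqI) simp

lemma scal_add_right: "scal c (f + g) = scal c f + scal c g"
  by (rule poly_mapping_eqI) (simp add: lookup_add algebra_simps)

lemma scal_add_left: "scal (c + d) f = scal c f + scal d f"
  by (rule poly_mapping_eqI) (simp add: lookup_add algebra_simps)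

lemma scal_diff_left: "scal (c - d) f = scal c f - scal d f"
  by (rule poly_mapping_eqI) (simp add: lookup_minus algebra_simps)

lemma scal_sum_right: "scal c (\<Sum>i\<in>S. f i) = (\<Sum>i\<in>S. scal c (f i))"
  by (induction S rule: infinite_finite_induct) (simp_all add: scal_add_right)

lemma scal_sum_left: "scal (\<Sum>i\<in>S. c i) f = (\<Sum>i\<in>S. scal (c i) f)"
  by (induction S rule: infinite_finite_induct) (simp_all add: scal_add_left)

lemma scal_mult_scal: "scal c f * scal d g = scal (c * d) (f * g)"
proof -
  have "scal c f * scal d g = Poly_Mapping.single 0 c * (f * Poly_Mapping.single 0 d) * g"
    by (simp add: scal_conv_mult mult.assoc)
  also have "\<dots> = (Poly_Mapping.single 0 c * Poly_Mapping.single 0 d) * (f * g)"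
    by (simp only: subst.e_central[of d f, symmetric] mult.assoc)
  finally show ?thesis by (simp add: scal_conv_mult mult_single)
qed

lemma anticomm_sums:
  "anticomm (\<Sum>i\<in>S. scal (c i) (f i)) (\<Sum>j\<in>T. scal (d j) (g j)) =
    (\<Sum>i\<in>S. \<Sum>j\<in>T. scal (c i * d j) (anticomm (f i) (g j)))"
proof -
  have "(\<Sum>j\<in>T. \<Sum>i\<in>S. scal (d j * c i) (g j * f i)) = (\<Sum>i\<in>S. \<Sum>j\<in>T. scal (c i * d j) (g j * f i))"
    by (subst sum.swap) (simp add: mult.commute)
  then show ?thesis
    by (simp add: anticomm_def sum_product scal_mult_scal scal_add_right sum.distrib)
qed

lemma anticomm_self: "anticomm f f = scal 2 (f\<^sup>2)"
  using scal_add_left[of 1 1 "f\<^sup>2"] by (simp add: anticomm_def power2_eq_square)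

lemma anticomm_commute: "anticomm f g = anticomm g f"
  by (simp add: anticomm_def add.commute)

lemma subst_anticomm: "subst.eval g (anticomm f1 f2) = anticomm (subst.eval g f1) (subst.eval g f2)"
  by (simp add: anticomm_def subst.eval_add subst.eval_mult)

lemma gen_cong: "[i = j] (mod int p) \<Longrightarrow> gen p i = gen p j"
  by (simp add: gen_def Cong.cong_def)

lemma gen_eq_var: "i \<in> {0..<int p} \<Longrightarrow> gen p i = var i"
  by (simp add: gen_def)

lemma gen_closed: "p > 0 \<Longrightarrow> gen p i \<in> carrier (free_algebra {0..<int p})"
  by (simp add: gen_def)

lemma anticomm_closed:
  "f \<in> carrier (free_algebra X) \<Longrightarrow> g \<in> carrier (free_algebra X) \<Longrightarrow> anticomm f g \<in> carrier (free_algebra X)"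
  by (auto simp: anticomm_def)

section \<open>Generators and relations\<close>

definition quantum_relations :: "nat \<Rightarrow> (int word \<Rightarrow>\<^sub>0 complex) set"
  where "quantum_relations p =
    {anticomm (gen p i) (gen p j) | i j. i \<in> {0..<int p} \<and> j \<in> {0..<int p} \<and> i \<noteq> j}"

lemma quantum_relationsI:
  "i \<in> {0..<int p} \<Longrightarrow> j \<in> {0..<int p} \<Longrightarrow> i \<noteq> j \<Longrightarrow>
    anticomm (gen p i) (gen p j) \<in> quantum_relations p"
  unfolding quantum_relations_def by blast

lemma quantum_relations_closed: "p > 0 \<Longrightarrow> quantum_relations p \<subseteq> carrier (free_algebra {0..<int p})"
  by (auto simp: quantum_relations_def intro!: anticomm_closed gen_closed)

lemma clifford_relations_closed: "p > 0 \<Longrightarrow> clifford_relations p a \<subseteq> carrier (free_algebra {0..<int p})"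
  by (auto simp: clifford_relations_def power2_eq_square
      intro!: free_algebra_diff free_algebra_scal free_algebra_mult anticomm_closed gen_closed)

text \<open>The Clifford relations only mention differences from \<open>1\<close> to \<open>(p - 1) / 2\<close>. Up to the order of
the two indices this is no restriction.\<close>

lemma incongruent_cases:
  assumes "odd p" "\<not> [i = j] (mod int p)"
  obtains d where "d \<in> {1..(p - 1) div 2}" "[j = i + int d] (mod int p)"
    | d where "d \<in> {1..(p - 1) div 2}" "[i = j + int d] (mod int p)"
proof -
  have p0: "p > 0" using assms(1) by (cases p) auto
  define r where "r = (j - i) mod int p"
  have r: "0 \<le> r" "r < int p" "[r = j - i] (mod int p)"
    using p0 by (simp_all add: r_def Cong.cong_def)
  have "r \<noteq> 0"
    using assms(2) r(3) by (metis cong_diff_iff_cong_0 cong_sym)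
  obtain n where n: "p = 2 * n + 1" using assms(1) by (auto elim: oddE)
  show ?thesis
  proof (cases "r \<le> int n")
    case True
    have "[i + r = i + (j - i)] (mod int p)" by (intro cong_add cong_refl r(3))
    then show ?thesis
      using True r \<open>r \<noteq> 0\<close> n by (intro that(1)[of "nat r"]) (auto simp: cong_sym_eq)
  next
    case False
    have "[j - r + int p * 1 = j - (j - i) + int p * 0] (mod int p)"
      by (intro cong_add cong_diff cong_refl r(3)) (simp add: Cong.cong_def)
    then have "[i = j + (int p - r)] (mod int p)"
      by (simp add: cong_sym_eq algebra_simps)
    then show ?thesis
      using False r n by (intro that(2)[of "nat (int p - r)"]) auto
  qed
qed

section \<open>The quadratic Fourier substitution\<close>

text \<open>The candidates for the points, indexed by \<open>\<int>/p\<int>\<close> together with \<open>None\<close> for the point at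
infinity.\<close>

definition normal_coords :: "nat \<Rightarrow> int option \<Rightarrow> nat \<Rightarrow> complex"
  where "normal_coords p x = (\<lambda>i\<in>{0..(p - 1) div 2}. if i = 0 then 1 else
    (case x of None \<Rightarrow> 0 | Some c \<Rightarrow> 2 * unity_root p (c * int i ^ 2)))"

text \<open>The Fourier transform of \<open>\<int>/p\<int>\<close> twisted by the quadratic phase \<open>2 c j\<^sup>2\<close>. The phase is chosen
so that two indices \<open>m - d\<close>, \<open>m + d\<close> with midpoint \<open>m\<close> have total phase
\<open>2 (2 c m\<^sup>2) + c (2 d)\<^sup>2\<close>: twice the phase of the midpoint plus a term in their difference
\<open>2 d\<close> only, which becomes the exponent in \<open>normal_coords p (Some c)\<close>.\<close>

definition fourier :: "nat \<Rightarrow> int \<Rightarrow> int \<Rightarrow> (int word \<Rightarrow>\<^sub>0 complex)"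
  where "fourier p c j = (\<Sum>k\<in>{0..<int p}. scal (unity_root p (k * j + 2 * c * j ^ 2)) (var k))"

definition inv_fourier :: "nat \<Rightarrow> int \<Rightarrow> int \<Rightarrow> (int word \<Rightarrow>\<^sub>0 complex)"
  where "inv_fourier p c k =
    (\<Sum>j\<in>{0..<int p}. scal (unity_root p (- (k * j + 2 * c * j ^ 2)) / of_nat p) (var j))"

context
  fixes p :: nat and c :: int
  assumes odd: "odd p"
begin

lemma p_pos: "p > 0" using odd by (cases p) auto

lemma fourier_closed: "fourier p c j \<in> carrier (free_algebra {0..<int p})"
  unfolding fourier_def by (intro free_algebra_sum_closed free_algebra_scal var_in_free_algebra)

lemma inv_fourier_closed: "inv_fourier p c j \<in> carrier (free_algebra {0..<int p})"
  unfolding inv_fourier_def by (intro free_algebra_sum_closed free_algebra_scal var_in_free_algebra)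

lemma fourier_cong:
  assumes "[i = j] (mod int p)"
  shows "fourier p c i = fourier p c j"
  unfolding fourier_def
  by (intro sum.cong refl arg_cong2[where f = scal] unity_root_cong[OF p_pos]
      cong_add cong_mult cong_pow cong_refl assms)

lemma subst_fourier_gen: "subst.eval (fourier p c) (gen p j) = fourier p c j"
  by (simp add: gen_def) (rule fourier_cong, simp add: Cong.cong_def)

lemma subst_inv_fourier_fourier:
  assumes "a \<in> {0..<int p}"
  shows "subst.eval (inv_fourier p c) (fourier p c a) = var a"
proof -
  let ?X = "{0..<int p}"
  have "subst.eval (inv_fourier p c) (fourier p c a) =
      (\<Sum>k\<in>?X. scal (unity_root p (k * a + 2 * c * a ^ 2)) (inv_fourier p c k))"
    by (simp add: fourier_def subst.eval_sum subst_scal)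
  also have "\<dots> = (\<Sum>k\<in>?X. \<Sum>j\<in>?X.
      scal (unity_root p (2 * c * (a ^ 2 - j ^ 2)) / of_nat p * unity_root p ((a - j) * k)) (var j))"
    unfolding inv_fourier_def scal_sum_right scal_scal times_divide_eq_right times_divide_eq_left
      unity_root_add[symmetric]
    by (intro sum.cong refl arg_cong2[where f = scal] arg_cong2[where f = "(/)"] arg_cong[where f = "unity_root p"])
       (simp add: algebra_simps)
  also have "\<dots> = (\<Sum>j\<in>?X. scal (unity_root p (2 * c * (a ^ 2 - j ^ 2)) / of_nat p *
      (\<Sum>k\<in>?X. unity_root p ((a - j) * k))) (var j))"
    by (subst sum.swap) (simp add: scal_sum_left sum_distrib_left)
  also have "\<dots> = (\<Sum>j\<in>?X. if j = a then var j else 0)"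
  proof (rule sum.cong)
    fix j assume j: "j \<in> ?X"
    have "[a - j = 0] (mod int p) \<longleftrightarrow> j = a"
      using j assms by (auto simp: cong_diff_iff_cong_0 cong_less_imp_eq_int cong_sym)
    then show "scal (unity_root p (2 * c * (a ^ 2 - j ^ 2)) / of_nat p *
        (\<Sum>k\<in>?X. unity_root p ((a - j) * k))) (var j) = (if j = a then var j else 0)"
      using p_pos by (simp add: sum_unity_root)
  qed simp
  finally show ?thesis using assms by simp
qed

lemma subst_fourier_inv_fourier:
  assumes "b \<in> {0..<int p}"
  shows "subst.eval (fourier p c) (inv_fourier p c b) = var b"
proof -
  let ?X = "{0..<int p}"
  have "subst.eval (fourier p c) (inv_fourier p c b) =
      (\<Sum>j\<in>?X. scal (unity_root p (- (b * j + 2 * c * j ^ 2)) / of_nat p) (fourier p c j))"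
    by (simp add: inv_fourier_def subst.eval_sum subst_scal)
  also have "\<dots> = (\<Sum>j\<in>?X. \<Sum>k\<in>?X. scal (1 / of_nat p * unity_root p ((k - b) * j)) (var k))"
    unfolding fourier_def scal_sum_right scal_scal times_divide_eq_right times_divide_eq_left
      unity_root_add[symmetric] mult_1_left
    by (intro sum.cong refl arg_cong2[where f = scal] arg_cong2[where f = "(/)"] arg_cong[where f = "unity_root p"])
       (simp add: algebra_simps)
  also have "\<dots> = (\<Sum>k\<in>?X. scal (1 / of_nat p * (\<Sum>j\<in>?X. unity_root p ((k - b) * j))) (var k))"
    by (subst sum.swap) (simp only: scal_sum_left sum_distrib_left)
  also have "\<dots> = (\<Sum>k\<in>?X. if k = b then var k else 0)"
  proof (rule sum.cong)
    fix k assume k: "k \<in> ?X"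
    have "[k - b = 0] (mod int p) \<longleftrightarrow> k = b"
      using k assms by (auto simp: cong_diff_iff_cong_0 cong_less_imp_eq_int)
    then show "scal (1 / of_nat p * (\<Sum>j\<in>?X. unity_root p ((k - b) * j))) (var k) =
        (if k = b then var k else 0)"
      using p_pos by (simp add: sum_unity_root)
  qed simp
  finally show ?thesis using assms by simp
qed

context
  fixes I
  assumes I: "ideal I (free_algebra {0..<int p})"
begin

text \<open>Modulo the relations of the quantum space, only the squares of the generators survive in an
anticommutator of linear forms. So the two sides have to be compared on the diagonal, where the
identity \<open>2 s\<^sup>2 + 2 t\<^sup>2 = (s + t)\<^sup>2 + (t - s)\<^sup>2\<close> for the quadratic phases gives equality.\<close>

lemma fourier_clifford_relation:
  assumes Q: "\<And>k l. k \<in> {0..<int p} \<Longrightarrow> l \<in> {0..<int p} \<Longrightarrow> k \<noteq> l \<Longrightarrow> anticomm (var k) (var l) \<in> I"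
    and m: "[2 * m = s + t] (mod int p)"
  shows "anticomm (fourier p c s) (fourier p c t)
    - scal (2 * unity_root p (c * (t - s) ^ 2)) ((fourier p c m)\<^sup>2) \<in> I"
proof -
  let ?X = "{0..<int p}" and ?u = "unity_root p (c * (t - s) ^ 2)"
  let ?e = "\<lambda>j k. unity_root p (k * j + 2 * c * j ^ 2)"
  have "scal (2 * ?u) ((fourier p c m)\<^sup>2) = scal ?u (anticomm (fourier p c m) (fourier p c m))"
    by (simp add: anticomm_self scal_scal mult.commute)
  then have eq: "anticomm (fourier p c s) (fourier p c t) - scal (2 * ?u) ((fourier p c m)\<^sup>2) =
      (\<Sum>k\<in>?X. \<Sum>l\<in>?X. scal (?e s k * ?e t l - ?u * (?e m k * ?e m l)) (anticomm (var k) (var l)))"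
    unfolding fourier_def anticomm_sums
    by (simp add: scal_sum_right scal_scal scal_diff_left sum_subtractf)
  have diag: "?e s k * ?e t k - ?u * (?e m k * ?e m k) = 0" for k
  proof -
    have "[(k * s + 2 * c * s ^ 2) + (k * t + 2 * c * t ^ 2) =
        c * (t - s) ^ 2 + (k * (2 * m) + c * (2 * m) ^ 2)] (mod int p)"
    proof -
      have "[c * (t - s) ^ 2 + (k * (2 * m) + c * (2 * m) ^ 2) =
          c * (t - s) ^ 2 + (k * (s + t) + c * (s + t) ^ 2)] (mod int p)"
        by (intro cong_add cong_mult cong_pow cong_refl m)
      also have "c * (t - s) ^ 2 + (k * (s + t) + c * (s + t) ^ 2) =
          (k * s + 2 * c * s ^ 2) + (k * t + 2 * c * t ^ 2)"
        by (simp add: power2_eq_square algebra_simps)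
      finally show ?thesis by (rule cong_sym)
    qed
    also have "c * (t - s) ^ 2 + (k * (2 * m) + c * (2 * m) ^ 2) =
        c * (t - s) ^ 2 + ((k * m + 2 * c * m ^ 2) + (k * m + 2 * c * m ^ 2))"
      by (simp add: power2_eq_square algebra_simps)
    finally have "?e s k * ?e t k = ?u * (?e m k * ?e m k)"
      unfolding unity_root_add[symmetric] by (rule unity_root_cong[OF p_pos])
    then show ?thesis by simp
  qed
  show ?thesis
    unfolding eq
  proof (intro ideal_sum[OF I])
    fix k l assume kl: "k \<in> ?X" "l \<in> ?X"
    show "scal (?e s k * ?e t l - ?u * (?e m k * ?e m l)) (anticomm (var k) (var l)) \<in> I"
    proof (cases "k = l")
      case True
      then show ?thesis using ideal_zero[OF I] by (simp add: diag)
    qed (intro ideal_scal[OF I] Q kl)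
  qed
qed

text \<open>The defining relations, extended to arbitrary pairs of indices; for congruent indices the
statement is \<open>2 x\<^sup>2 = 2 x\<^sup>2\<close>. This uniform version is what can be summed over all pairs.\<close>

lemma clifford_relation_cong:
  assumes C: "clifford_relations p (normal_coords p (Some c)) \<subseteq> I"
    and m: "[2 * m = s + t] (mod int p)"
  shows "anticomm (gen p s) (gen p t) - scal (2 * unity_root p (c * (t - s) ^ 2)) ((gen p m)\<^sup>2) \<in> I"
proof -
  have rel: "anticomm (gen p s) (gen p t) - scal (2 * unity_root p (c * (t - s) ^ 2)) ((gen p m)\<^sup>2) \<in> I"
    if d: "d \<in> {1..(p - 1) div 2}" and t: "[t = s + int d] (mod int p)"
      and m: "[2 * m = s + t] (mod int p)" for d s t
  proof -
    define j where "j = s mod int p"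
    have j: "[j = s] (mod int p)" "j \<in> {0..<int p}"
      using p_pos by (auto simp: j_def Cong.cong_def)
    let ?r = "scal (normal_coords p (Some c) 0) (anticomm (gen p j) (gen p (j + int d)))
      - scal (normal_coords p (Some c) d) ((gen p (j + half p d))\<^sup>2)"
    have "?r \<in> I"
      using C d j(2) unfolding clifford_relations_def by blast
    moreover have "gen p j = gen p s" by (rule gen_cong) (rule j)
    moreover have "gen p (j + int d) = gen p t"
      by (rule gen_cong) (rule cong_trans[OF cong_add[OF j(1) cong_refl] cong_sym[OF t]])
    moreover have "gen p (j + half p d) = gen p m"
    proof (rule gen_cong, rule cong_cancel_2[OF odd])
      have "[2 * j + 2 * half p d = 2 * s + int d] (mod int p)"
        by (intro cong_add cong_mult cong_refl cong_half[OF odd] j)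
      moreover have "[s + t = s + (s + int d)] (mod int p)"
        by (intro cong_add cong_refl t)
      ultimately show "[2 * (j + half p d) = 2 * m] (mod int p)"
        using cong_trans[OF m] by (metis cong_sym cong_trans distrib_left mult_2 add.assoc)
    qed
    moreover have "unity_root p (c * int d ^ 2) = unity_root p (c * (t - s) ^ 2)"
    proof (rule unity_root_cong[OF p_pos])
      have "[c * (t - s) ^ 2 = c * ((s + int d) - s) ^ 2] (mod int p)"
        by (intro cong_mult cong_pow cong_diff cong_refl t)
      then show "[c * int d ^ 2 = c * (t - s) ^ 2] (mod int p)"
        by (simp add: cong_sym_eq)
    qed
    ultimately show ?thesis
      using d by (simp add: normal_coords_def)
  qed
  show ?thesis
  proof (cases "[s = t] (mod int p)")
    case True
    then have "[2 * m = 2 * s] (mod int p)"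
      using cong_trans[OF m cong_add[OF cong_refl cong_sym[OF True]]] by simp
    then have "[m = s] (mod int p)" by (rule cong_cancel_2[OF odd])
    then have "gen p m = gen p s" "gen p t = gen p s"
      using True by (auto intro: gen_cong cong_sym)
    moreover have "unity_root p (c * (t - s) ^ 2) = unity_root p (c * (s - s) ^ 2)"
      by (intro unity_root_cong[OF p_pos] cong_mult cong_pow cong_diff cong_refl cong_sym[OF True])
    ultimately show ?thesis
      using ideal_zero[OF I] by (simp add: anticomm_self)
  next
    case False
    then show ?thesis
    proof (rule incongruent_cases[OF odd])
      fix d assume "d \<in> {1..(p - 1) div 2}" "[t = s + int d] (mod int p)"
      then show ?thesis using m by (rule rel)
    next
      fix d assume "d \<in> {1..(p - 1) div 2}" "[s = t + int d] (mod int p)"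
      from rel[OF this] m show ?thesis
        by (simp add: add.commute anticomm_commute power2_commute)
    qed
  qed
qed

text \<open>By the Clifford relations the anticommutator is a combination of the squares of the generators.
Summing over pairs of indices by midpoint \<open>m\<close> and offset \<open>d\<close>, the quadratic phases in \<open>d\<close>
cancel against the coefficient of the relation, and the coefficient of the square with index \<open>m\<close>
is a multiple of the character sum \<open>\<Sum>\<^sub>d \<zeta>^((k - l) d)\<close>, which vanishes for \<open>k \<noteq> l\<close>.\<close>

lemma inv_fourier_quantum_relation:
  assumes C: "clifford_relations p (normal_coords p (Some c)) \<subseteq> I"
    and kl: "k \<in> {0..<int p}" "l \<in> {0..<int p}" "k \<noteq> l"
  shows "anticomm (inv_fourier p c k) (inv_fourier p c l) \<in> I"
proof -
  let ?X = "{0..<int p}"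
  let ?e = "\<lambda>k j. unity_root p (- (k * j + 2 * c * j ^ 2)) / of_nat p"
  let ?w = "\<lambda>i j. 2 * unity_root p (c * (j - i) ^ 2)"
  define mid where "mid i j = (i + j) * modular_inverse (int p) 2" for i j
  have mid: "[2 * mid i j = i + j] (mod int p)" for i j
  proof -
    have "[(i + j) * (2 * modular_inverse (int p) 2) = (i + j) * 1] (mod int p)"
      using odd by (intro cong_mult cong_refl cong_modular_inverse1) simp
    then show ?thesis by (simp add: mid_def algebra_simps)
  qed
  let ?N = "\<Sum>i\<in>?X. \<Sum>j\<in>?X. scal (?e k i * ?e l j)
    (anticomm (gen p i) (gen p j) - scal (?w i j) ((gen p (mid i j))\<^sup>2))"
  let ?M = "\<Sum>i\<in>?X. \<Sum>j\<in>?X. scal (?e k i * ?e l j * ?w i j) ((gen p (mid i j))\<^sup>2)"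
  have "anticomm (inv_fourier p c k) (inv_fourier p c l) =
      (\<Sum>i\<in>?X. \<Sum>j\<in>?X. scal (?e k i * ?e l j) (anticomm (gen p i) (gen p j)))"
    unfolding inv_fourier_def anticomm_sums by (intro sum.cong refl) (simp add: gen_eq_var)
  also have "\<dots> = ?N + ?M"
    by (simp add: scal_diff scal_scal sum_subtractf)
  also have "?M = 0"
  proof -
    (* As 2 is invertible modulo p, a pair of indices is the same as a midpoint and an offset. *)
    let ?f = "\<lambda>(m, d). ((m - d) mod int p, (m + d) mod int p)"
    have inj: "inj_on ?f (?X \<times> ?X)"
    proof (rule inj_onI, clarify)
      fix m d m' d' assume X: "m \<in> ?X" "d \<in> ?X" "m' \<in> ?X" "d' \<in> ?X"
        and "(m - d) mod int p = (m' - d') mod int p" "(m + d) mod int p = (m' + d') mod int p"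
      then have eq: "[m - d = m' - d'] (mod int p)" "[m + d = m' + d'] (mod int p)"
        by (simp_all add: Cong.cong_def)
      have "[2 * m = 2 * m'] (mod int p)" "[2 * d = 2 * d'] (mod int p)"
        using cong_add[OF eq] cong_diff[OF eq(2) eq(1)] by simp_all
      then have "[m = m'] (mod int p)" "[d = d'] (mod int p)"
        using cong_cancel_2[OF odd] by blast+
      with X show "m = m' \<and> d = d'" by (auto intro: cong_less_imp_eq_int)
    qed
    have "?f ` (?X \<times> ?X) \<subseteq> ?X \<times> ?X" using p_pos by auto
    then have bij: "bij_betw ?f (?X \<times> ?X) (?X \<times> ?X)"
      using inj by (intro bij_betw_imageI endo_inj_surj) auto
    have summand: "scal (?e k i * ?e l j * ?w i j) ((gen p (mid i j))\<^sup>2) =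
        scal (2 / of_nat p ^ 2 * unity_root p (- (k + l) * m - 4 * c * m ^ 2) * unity_root p ((k - l) * d))
          ((gen p m)\<^sup>2)"
      if i: "[i = m - d] (mod int p)" and j: "[j = m + d] (mod int p)" for i j m d
    proof (intro arg_cong2[where f = scal])
      have "[2 * mid i j = (m - d) + (m + d)] (mod int p)"
        by (rule cong_trans[OF mid cong_add[OF i j]])
      then have "[mid i j = m] (mod int p)"
        using cong_cancel_2[OF odd, of "mid i j" m] by simp
      then show "(gen p (mid i j))\<^sup>2 = (gen p m)\<^sup>2" by (simp only: gen_cong)
      have "[c * (j - i) ^ 2 - (k * i + 2 * c * i ^ 2) - (l * j + 2 * c * j ^ 2) =
          c * ((m + d) - (m - d)) ^ 2 - (k * (m - d) + 2 * c * (m - d) ^ 2)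
          - (l * (m + d) + 2 * c * (m + d) ^ 2)] (mod int p)"
        by (intro cong_diff cong_add cong_mult cong_pow cong_refl i j)
      also have "c * ((m + d) - (m - d)) ^ 2 - (k * (m - d) + 2 * c * (m - d) ^ 2)
          - (l * (m + d) + 2 * c * (m + d) ^ 2) = (- (k + l) * m - 4 * c * m ^ 2) + (k - l) * d"
        by (simp add: power2_eq_square algebra_simps)
      also have "c * (j - i) ^ 2 - (k * i + 2 * c * i ^ 2) - (l * j + 2 * c * j ^ 2) =
          - (k * i + 2 * c * i ^ 2) + - (l * j + 2 * c * j ^ 2) + c * (j - i) ^ 2" by simp
      finally have "unity_root p (- (k * i + 2 * c * i ^ 2)) * unity_root p (- (l * j + 2 * c * j ^ 2)) *
          unity_root p (c * (j - i) ^ 2) =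
          unity_root p (- (k + l) * m - 4 * c * m ^ 2) * unity_root p ((k - l) * d)"
        unfolding unity_root_add[symmetric] by (rule unity_root_cong[OF p_pos])
      then show "?e k i * ?e l j * ?w i j = 2 / of_nat p ^ 2 *
          unity_root p (- (k + l) * m - 4 * c * m ^ 2) * unity_root p ((k - l) * d)"
        by (simp add: power2_eq_square mult.assoc)
    qed
    have "?M = (\<Sum>(i, j)\<in>?X \<times> ?X. scal (?e k i * ?e l j * ?w i j) ((gen p (mid i j))\<^sup>2))"
      by (rule sum.cartesian_product)
    also have "\<dots> = (\<Sum>x\<in>?X \<times> ?X. (\<lambda>(i, j). scal (?e k i * ?e l j * ?w i j) ((gen p (mid i j))\<^sup>2)) (?f x))"
      by (rule sum.reindex_bij_betw[OF bij, symmetric])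
    also have "\<dots> = (\<Sum>(m, d)\<in>?X \<times> ?X.
        scal (2 / of_nat p ^ 2 * unity_root p (- (k + l) * m - 4 * c * m ^ 2) * unity_root p ((k - l) * d))
          ((gen p m)\<^sup>2))"
    proof (rule sum.cong[OF refl])
      fix x :: "int \<times> int"
      obtain m d where x: "x = (m, d)" by (cases x)
      show "(\<lambda>(i, j). scal (?e k i * ?e l j * ?w i j) ((gen p (mid i j))\<^sup>2)) (?f x) =
        (\<lambda>(m, d). scal (2 / of_nat p ^ 2 * unity_root p (- (k + l) * m - 4 * c * m ^ 2) *
          unity_root p ((k - l) * d)) ((gen p m)\<^sup>2)) x"
        unfolding x prod.case by (rule summand) (simp_all add: Cong.cong_def)
    qed
    also have "\<dots> = (\<Sum>m\<in>?X. scal (2 / of_nat p ^ 2 * unity_root p (- (k + l) * m - 4 * c * m ^ 2) *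
        (\<Sum>d\<in>?X. unity_root p ((k - l) * d))) ((gen p m)\<^sup>2))"
      by (simp only: sum.cartesian_product[symmetric] scal_sum_left sum_distrib_left)
    also have "\<not> [k - l = 0] (mod int p)"
      using kl by (auto simp: cong_diff_iff_cong_0 dest: cong_less_imp_eq_int)
    then have "(\<Sum>m\<in>?X. scal (2 / of_nat p ^ 2 * unity_root p (- (k + l) * m - 4 * c * m ^ 2) *
        (\<Sum>d\<in>?X. unity_root p ((k - l) * d))) ((gen p m)\<^sup>2)) = 0"
      by (simp add: sum_unity_root[OF p_pos])
    finally show ?thesis .
  qed
  also have "?N + 0 \<in> I"
    unfolding add_0_right
    by (intro ideal_sum[OF I] ideal_scal[OF I] clifford_relation_cong[OF C mid])
  finally show ?thesis .
qed

end

end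

section \<open>Which Clifford algebras are quantum spaces\<close>

lemma clifford_iso_quantum_Some:
  assumes "odd p"
  shows "clifford_algebra p (normal_coords p (Some c)) \<simeq>\<^sub>a\<^sub>l\<^sub>g quantum_space p"
proof -
  let ?F = "free_algebra {0..<int p}"
  let ?R = "clifford_relations p (normal_coords p (Some c))"
  note p0 = p_pos[OF assms]
  note R = clifford_relations_closed[OF p0, of "normal_coords p (Some c)"]
  note S = quantum_relations_closed[OF p0]
  note ring = ring_free_algebra[of "{0..<int p}"]
  have idl_R: "ideal (Idl\<^bsub>?F\<^esub> ?R) ?F" and idl_S: "ideal (Idl\<^bsub>?F\<^esub> quantum_relations p) ?F"
    using ring.genideal_ideal[OF ring R] ring.genideal_ideal[OF ring S] by auto
  have Q: "anticomm (var k) (var l) \<in> Idl\<^bsub>?F\<^esub> quantum_relations p"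
    if "k \<in> {0..<int p}" "l \<in> {0..<int p}" "k \<noteq> l" for k l
  proof -
    have "anticomm (gen p k) (gen p l) \<in> quantum_relations p"
      using that by (rule quantum_relationsI)
    then show ?thesis
      using that ring.genideal_self[OF ring S] by (auto simp: gen_eq_var)
  qed
  have "?F AlgQuot (Idl\<^bsub>?F\<^esub> ?R) \<simeq>\<^sub>a\<^sub>l\<^sub>g ?F AlgQuot (Idl\<^bsub>?F\<^esub> quantum_relations p)"
  proof (rule presentation_iso[where g = "fourier p c" and h = "inv_fourier p c"])
    fix r assume "r \<in> ?R"
    then consider (square) j i where "i \<in> {1..(p - 1) div 2}"
        "r = scal (normal_coords p (Some c) 0) (anticomm (gen p j) (gen p (j + int i)))
          - scal (normal_coords p (Some c) i) ((gen p (j + half p i))\<^sup>2)"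
      | (mixed) k i m where "i \<in> {1..(p - 1) div 2}" "m \<in> {1..(p - 1) div 2}"
        "r = scal (normal_coords p (Some c) m) (anticomm (gen p (k - half p i)) (gen p (k + half p i)))
          - scal (normal_coords p (Some c) i) (anticomm (gen p (k - half p m)) (gen p (k + half p m)))"
      unfolding clifford_relations_def by blast
    then show "subst.eval (fourier p c) r \<in> Idl\<^bsub>?F\<^esub> quantum_relations p"
    proof cases
      case square
      have "[2 * (j + half p i) = j + (j + int i)] (mod int p)"
        using cong_add[OF cong_refl[of "2 * j"] cong_half[OF assms, of i]] by (simp add: algebra_simps)
      from fourier_clifford_relation[OF assms idl_S Q this, of c] show ?thesis
        using square by (simp add: normal_coords_def subst.eval_diff subst_scal subst_anticomm
            subst.eval_mult subst_fourier_gen[OF assms] power2_eq_square)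
    next
      case mixed
      let ?a = "normal_coords p (Some c)"
      (* A relation of the second family is a combination of two relations of the first kind
         with the same midpoint k, in which the square cancels. *)
      define r' where "r' i = anticomm (fourier p c (k - half p i)) (fourier p c (k + half p i))
        - scal (?a i) ((fourier p c k)\<^sup>2)" for i
      have r': "r' i \<in> Idl\<^bsub>?F\<^esub> quantum_relations p" if "i \<in> {1..(p - 1) div 2}" for i
      proof -
        have "unity_root p (c * ((k + half p i) - (k - half p i)) ^ 2) = unity_root p (c * int i ^ 2)"
          using cong_half[OF assms, of i] by (intro unity_root_cong[OF p0] cong_mult cong_pow) simp_all
        then show ?thesis
          using fourier_clifford_relation[OF assms idl_S Q, of k "k - half p i" "k + half p i" c] that
          by (simp add: r'_def normal_coords_def)
      qed
      have "subst.eval (fourier p c) r = scal (?a m) (r' i) - scal (?a i) (r' m)"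
        by (simp add: mixed(3) r'_def subst.eval_diff subst_scal subst_anticomm
            subst_fourier_gen[OF assms] scal_diff scal_scal mult.commute)
      then show ?thesis
        using ideal_diff[OF idl_S ideal_scal[OF idl_S r'] ideal_scal[OF idl_S r']] mixed by simp
    qed
  next
    fix s assume "s \<in> quantum_relations p"
    then obtain k l where kl: "k \<in> {0..<int p}" "l \<in> {0..<int p}" "k \<noteq> l"
      and s: "s = anticomm (var k) (var l)"
      unfolding quantum_relations_def by (auto simp: gen_eq_var)
    from inv_fourier_quantum_relation[OF assms idl_R ring.genideal_self[OF ring R] kl]
    show "subst.eval (inv_fourier p c) s \<in> Idl\<^bsub>?F\<^esub> ?R"
      by (simp add: s subst_anticomm)
  qed (use R S assms in \<open>simp_all add: fourier_closed inv_fourier_closed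
        subst_inv_fourier_fourier subst_fourier_inv_fourier\<close>)
  then show ?thesis
    by (simp add: clifford_algebra_def quantum_space_def quantum_relations_def)
qed

text \<open>At \<open>(1 : 0 : \<dots> : 0)\<close> the second family of relations is zero and the first consists of the
relations of the quantum space, except that each unordered pair of indices is listed only once.\<close>

lemma clifford_iso_quantum_None:
  assumes "odd p"
  shows "clifford_algebra p (normal_coords p None) \<simeq>\<^sub>a\<^sub>l\<^sub>g quantum_space p"
proof -
  let ?F = "free_algebra {0..<int p}"
  let ?R = "clifford_relations p (normal_coords p None)"
  note p0 = p_pos[OF assms]
  note R = clifford_relations_closed[OF p0, of "normal_coords p None"]
  note S = quantum_relations_closed[OF p0]
  note ring = ring_free_algebra[of "{0..<int p}"]
  have idl_R: "ideal (Idl\<^bsub>?F\<^esub> ?R) ?F" and idl_S: "ideal (Idl\<^bsub>?F\<^esub> quantum_relations p) ?F"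
    using ring.genideal_ideal[OF ring R] ring.genideal_ideal[OF ring S] by auto
  have "?F AlgQuot (Idl\<^bsub>?F\<^esub> ?R) \<simeq>\<^sub>a\<^sub>l\<^sub>g ?F AlgQuot (Idl\<^bsub>?F\<^esub> quantum_relations p)"
  proof (rule presentation_iso[where g = var and h = var])
    fix r assume "r \<in> ?R"
    then consider (square) j i where "j \<in> {0..<int p}" "i \<in> {1..(p - 1) div 2}"
        "r = anticomm (gen p j) (gen p (j + int i))"
      | (mixed) "r = 0"
      unfolding clifford_relations_def normal_coords_def by auto
    then have "r \<in> Idl\<^bsub>?F\<^esub> quantum_relations p"
    proof cases
      case square
      let ?k = "(j + int i) mod int p"
      have "\<not> int p dvd int i"
        using square(2) by (auto dest!: dvd_imp_le)
      then have "(j + int i) mod int p \<noteq> j mod int p"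
        by (simp add: mod_eq_dvd_iff)
      then have "?k \<noteq> j" using square(1) by simp
      moreover have "?k \<in> {0..<int p}" using p0 by simp
      ultimately have "anticomm (gen p j) (gen p ?k) \<in> quantum_relations p"
        using square(1) by (intro quantum_relationsI) auto
      moreover have "gen p (j + int i) = gen p ?k" by (simp add: gen_def)
      ultimately have "r \<in> quantum_relations p" by (simp only: square(3))
      then show ?thesis using ring.genideal_self[OF ring S] by auto
    qed (simp add: ideal_zero[OF idl_S])
    then show "subst.eval var r \<in> Idl\<^bsub>?F\<^esub> quantum_relations p" by (simp add: subst_var)
  next
    fix s assume "s \<in> quantum_relations p"
    then obtain k l where kl: "k \<in> {0..<int p}" "l \<in> {0..<int p}" "k \<noteq> l"
      and s: "s = anticomm (gen p k) (gen p l)"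
      unfolding quantum_relations_def by auto
    have rel: "anticomm (gen p j) (gen p (j + int d)) \<in> ?R"
      if "j \<in> {0..<int p}" "d \<in> {1..(p - 1) div 2}" for j d
    proof -
      have "anticomm (gen p j) (gen p (j + int d)) =
          scal (normal_coords p None 0) (anticomm (gen p j) (gen p (j + int d)))
          - scal (normal_coords p None d) ((gen p (j + half p d))\<^sup>2)"
        using that by (simp add: normal_coords_def)
      then show ?thesis
        using that unfolding clifford_relations_def by blast
    qed
    have "\<not> [k = l] (mod int p)"
      using kl by (auto dest: cong_less_imp_eq_int)
    then have "s \<in> ?R"
    proof (rule incongruent_cases[OF assms])
      fix d assume d: "d \<in> {1..(p - 1) div 2}" "[l = k + int d] (mod int p)"
      then show ?thesis using rel[OF kl(1) d(1)] by (simp add: s gen_cong[OF d(2)])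
    next
      fix d assume d: "d \<in> {1..(p - 1) div 2}" "[k = l + int d] (mod int p)"
      then show ?thesis
        using rel[OF kl(2) d(1)] by (simp add: s gen_cong[OF d(2)] anticomm_commute)
    qed
    then show "subst.eval var s \<in> Idl\<^bsub>?F\<^esub> ?R"
      using ring.genideal_self[OF ring R] by (auto simp: subst_var)
  qed (use R S in simp_all)
  then show ?thesis
    by (simp add: clifford_algebra_def quantum_space_def quantum_relations_def)
qed

text \<open>Two characters of the quantum space, sending the first generator to \<open>0\<close> and \<open>1\<close> and all other
generators to \<open>0\<close>, pull back to characters of the Clifford algebra. These differ at a
preimage of the first generator, so their zeros are different points, one of which is not the
origin.\<close>

lemma nonzero_point_if_iso_quantum:
  assumes p: "p > 0" and iso: "clifford_algebra p a \<simeq>\<^sub>a\<^sub>l\<^sub>g quantum_space p"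
  obtains \<nu> j where "\<And>r. r \<in> clifford_relations p a \<Longrightarrow> scalar.eval \<nu> r = 0"
    "j \<in> {0..<int p}" "\<nu> j \<noteq> 0"
proof -
  let ?F = "free_algebra {0..<int p}"
  define I where "I = Idl\<^bsub>?F\<^esub> clifford_relations p a"
  define J where "J = Idl\<^bsub>?F\<^esub> quantum_relations p"
  note R = clifford_relations_closed[OF p, of a] and S = quantum_relations_closed[OF p]
  note ring = ring_free_algebra[of "{0..<int p}"]
  have I: "ideal I ?F" and J: "ideal J ?F"
    unfolding I_def J_def using ring.genideal_ideal[OF ring R] ring.genideal_ideal[OF ring S] by auto
  have "?F AlgQuot I \<simeq>\<^sub>a\<^sub>l\<^sub>g ?F AlgQuot J"
    using iso by (simp add: clifford_algebra_def quantum_space_def quantum_relations_def I_def J_def)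
  then obtain h where h: "h \<in> ring_iso (?F AlgQuot I) (?F AlgQuot J)"
      "\<And>c x. x \<in> carrier (?F AlgQuot I) \<Longrightarrow> h (c \<odot>\<^bsub>?F AlgQuot I\<^esub> x) = c \<odot>\<^bsub>?F AlgQuot J\<^esub> h x"
    unfolding algebra_isomorphic_def by blast
  have v0: "var 0 \<in> carrier ?F" using p by simp
  then have "J +>\<^bsub>?F\<^esub> var 0 \<in> h ` carrier (?F AlgQuot I)"
    using h(1) by (auto simp: ring_iso_def bij_betw_def quot_carrier[OF J])
  then obtain f where f: "f \<in> carrier ?F" "h (I +>\<^bsub>?F\<^esub> f) = J +>\<^bsub>?F\<^esub> var 0"
    by (auto simp: quot_carrier[OF I])
  have point: "\<exists>\<nu>. (\<forall>r\<in>clifford_relations p a. scalar.eval \<nu> r = 0) \<and> scalar.eval \<nu> f = t" for t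
  proof -
    let ?\<mu> = "\<lambda>k. if k = 0 then t else 0"
    have "scalar.eval ?\<mu> r = 0" if "r \<in> quantum_relations p" for r
      using that by (auto simp: quantum_relations_def anticomm_def scalar.eval_add scalar.eval_mult gen_eq_var)
    from character_of_point[OF S this] obtain \<chi> where \<chi>: "character (?F AlgQuot J) \<chi>"
        "\<And>f. f \<in> carrier ?F \<Longrightarrow> \<chi> (J +>\<^bsub>?F\<^esub> f) = scalar.eval ?\<mu> f"
      unfolding J_def by blast
    have "character (?F AlgQuot I) (\<chi> \<circ> h)"
      by (rule character_comp_iso[OF h \<chi>(1)])
    from point_of_character[OF R this[unfolded I_def]] obtain \<nu> where
        \<nu>: "\<And>f. f \<in> carrier ?F \<Longrightarrow> (\<chi> \<circ> h) (I +>\<^bsub>?F\<^esub> f) = scalar.eval \<nu> f"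
          "\<And>r. r \<in> clifford_relations p a \<Longrightarrow> scalar.eval \<nu> r = 0"
      unfolding I_def by blast
    have "scalar.eval \<nu> f = t"
      using \<nu>(1)[OF f(1)] f(2) \<chi>(2)[OF v0] by simp
    with \<nu>(2) show ?thesis by blast
  qed
  obtain \<nu>0 \<nu>1 where \<nu>: "\<forall>r\<in>clifford_relations p a. scalar.eval \<nu>0 r = 0" "scalar.eval \<nu>0 f = 0"
      "\<forall>r\<in>clifford_relations p a. scalar.eval \<nu>1 r = 0" "scalar.eval \<nu>1 f = 1"
    using point[of 0] point[of 1] by blast
  then have "\<exists>j\<in>{0..<int p}. \<nu>0 j \<noteq> \<nu>1 j"
    using scalar.eval_cong[OF f(1), of \<nu>0 \<nu>1] by force
  then obtain j where "j \<in> {0..<int p}" "\<nu>0 j \<noteq> 0 \<or> \<nu>1 j \<noteq> 0" by force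
  with \<nu>(1,3) that show ?thesis by blast
qed

lemma coefficients_if_iso_quantum:
  assumes p: "prime p" "p \<ge> 5" and iso: "clifford_algebra p a \<simeq>\<^sub>a\<^sub>l\<^sub>g quantum_space p"
    and a: "i0 \<le> (p - 1) div 2" "a i0 \<noteq> 0"
  obtains x where "x \<in> insert None (Some ` {0..<int p})" "a 0 \<noteq> 0"
    "\<And>i. i \<le> (p - 1) div 2 \<Longrightarrow> a i = a 0 * normal_coords p x i"
proof -
  have p0: "p > 0" using p by simp
  from nonzero_point_if_iso_quantum[OF p0 iso] obtain \<nu> j0 where
    \<nu>: "\<And>r. r \<in> clifford_relations p a \<Longrightarrow> scalar.eval \<nu> r = 0" and j0: "j0 \<in> {0..<int p}" "\<nu> j0 \<noteq> 0"
    by blast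
  define \<mu> where "\<mu> j = \<nu> (j mod int p)" for j
  have per: "\<mu> m = \<mu> n" if "[m = n] (mod int p)" for m n
    using that by (simp add: \<mu>_def Cong.cong_def)
  have rel: "2 * a 0 * (\<mu> j * \<mu> (j + int i)) = a i * \<mu> (j + half p i) ^ 2"
    if i: "i \<in> {1..(p - 1) div 2}" for j i
  proof -
    define j' where "j' = j mod int p"
    have j': "j' \<in> {0..<int p}" "[j' = j] (mod int p)"
      using p0 by (auto simp: j'_def Cong.cong_def)
    have "scal (a 0) (anticomm (gen p j') (gen p (j' + int i)))
        - scal (a i) ((gen p (j' + half p i))\<^sup>2) \<in> clifford_relations p a"
      unfolding clifford_relations_def using i j'(1) by blast
    from \<nu>[OF this] have "a 0 * (\<mu> j' * \<mu> (j' + int i) + \<mu> (j' + int i) * \<mu> j') =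
        a i * \<mu> (j' + half p i) ^ 2"
      by (simp add: scalar.eval_diff scalar.eval_scal anticomm_def scalar.eval_add scalar.eval_mult
          power2_eq_square gen_def \<mu>_def)
    moreover have "\<mu> j' = \<mu> j" "\<mu> (j' + int i) = \<mu> (j + int i)" "\<mu> (j' + half p i) = \<mu> (j + half p i)"
      by (intro per cong_add cong_refl j'(2))+
    ultimately show ?thesis by (simp add: algebra_simps)
  qed
  have "\<mu> j0 \<noteq> 0" using j0 by (simp add: \<mu>_def)
  from coefficients_of_common_zero[OF p per rel this a]
  have a0: "a 0 \<noteq> 0" and "(\<forall>i\<in>{1..(p - 1) div 2}. a i = 0) \<or>
    (\<exists>c\<in>{0..<int p}. \<forall>i\<in>{1..(p - 1) div 2}. a i = 2 * a 0 * unity_root p (c * int i ^ 2))"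
    by blast+
  then show ?thesis
  proof (elim disjE bexE)
    assume *: "\<forall>i\<in>{1..(p - 1) div 2}. a i = 0"
    show ?thesis
    proof (rule that[of None])
      fix i assume "i \<le> (p - 1) div 2"
      then show "a i = a 0 * normal_coords p None i"
        using * by (cases "i = 0") (simp_all add: normal_coords_def)
    qed (simp_all add: a0)
  next
    fix c assume c: "c \<in> {0..<int p}"
      and *: "\<forall>i\<in>{1..(p - 1) div 2}. a i = 2 * a 0 * unity_root p (c * int i ^ 2)"
    show ?thesis
    proof (rule that[of "Some c"])
      fix i assume "i \<le> (p - 1) div 2"
      then show "a i = a 0 * normal_coords p (Some c) i"
        using * by (cases "i = 0") (simp_all add: normal_coords_def)
    qed (use c a0 in simp_all)
  qed
qed

section \<open>Counting projective points\<close>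

definition proj_rel :: "('a, 'm) ring_scheme \<Rightarrow> nat \<Rightarrow> ((nat \<Rightarrow> 'a) \<times> (nat \<Rightarrow> 'a)) set"
  where "proj_rel K n = {(v, w). v \<in> nonzero_vectors K n \<and> w \<in> nonzero_vectors K n \<and>
    (\<exists>c \<in> carrier K - {\<zero>\<^bsub>K\<^esub>}. w = (\<lambda>i\<in>{0..n}. c \<otimes>\<^bsub>K\<^esub> v i))}"

lemma proj_space_quotient: "proj_space K n = nonzero_vectors K n // proj_rel K n"
  by (simp add: proj_space_def proj_rel_def)

lemma nonzero_vectors_carrier: "v \<in> nonzero_vectors K n \<Longrightarrow> i \<le> n \<Longrightarrow> v i \<in> carrier K"
  by (auto simp: nonzero_vectors_def)

lemma nonzero_vectors_nonzero:
  assumes "v \<in> nonzero_vectors K n"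
  obtains i where "i \<le> n" "v i \<noteq> \<zero>\<^bsub>K\<^esub>"
proof -
  have "v \<noteq> (\<lambda>i\<in>{0..n}. \<zero>\<^bsub>K\<^esub>)" "v \<in> extensional {0..n}"
    using assms by (auto simp: nonzero_vectors_def PiE_def)
  then have "\<exists>i\<in>{0..n}. v i \<noteq> \<zero>\<^bsub>K\<^esub>"
    by (metis extensionalityI restrict_apply' restrict_extensional)
  then show ?thesis using that by auto
qed

lemma (in field) equiv_proj_rel: "equiv (nonzero_vectors R n) (proj_rel R n)"
proof (rule equivI)
  show "proj_rel R n \<subseteq> nonzero_vectors R n \<times> nonzero_vectors R n"
    by (auto simp: proj_rel_def)
  show "refl_on (nonzero_vectors R n) (proj_rel R n)"
  proof (rule refl_onI)
    fix v assume v: "v \<in> nonzero_vectors R n"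
    then have "v = (\<lambda>i\<in>{0..n}. \<one> \<otimes> v i)"
      using nonzero_vectors_carrier[OF v]
      by (auto simp: nonzero_vectors_def PiE_def extensional_def fun_eq_iff)
    with v show "(v, v) \<in> proj_rel R n"
      by (auto simp: proj_rel_def intro!: bexI[of _ \<one>])
  qed
  show "sym (proj_rel R n)"
  proof (rule symI)
    fix v w assume "(v, w) \<in> proj_rel R n"
    then obtain c where v: "v \<in> nonzero_vectors R n" and w: "w \<in> nonzero_vectors R n"
      and c: "c \<in> carrier R" "c \<noteq> \<zero>" and eq: "w = (\<lambda>i\<in>{0..n}. c \<otimes> v i)"
      by (auto simp: proj_rel_def)
    have u: "c \<in> Units R" using c by (simp add: field_Units)
    have "v = (\<lambda>i\<in>{0..n}. inv c \<otimes> w i)"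
    proof
      fix i show "v i = (\<lambda>i\<in>{0..n}. inv c \<otimes> w i) i"
        using v u c nonzero_vectors_carrier[OF v, of i]
        by (auto simp: eq m_assoc[symmetric] nonzero_vectors_def PiE_def extensional_def)
    qed
    moreover have "inv c \<in> carrier R - {\<zero>}"
      using Units_inv_Units[OF u] by (simp add: field_Units)
    ultimately show "(w, v) \<in> proj_rel R n"
      using v w unfolding proj_rel_def by blast
  qed
  show "trans (proj_rel R n)"
  proof (rule transI)
    fix u v w assume "(u, v) \<in> proj_rel R n" "(v, w) \<in> proj_rel R n"
    then obtain c d where u: "u \<in> nonzero_vectors R n" and w: "w \<in> nonzero_vectors R n"
      and c: "c \<in> carrier R" "c \<noteq> \<zero>" and d: "d \<in> carrier R" "d \<noteq> \<zero>"
      and v: "v = (\<lambda>i\<in>{0..n}. c \<otimes> u i)" and eq: "w = (\<lambda>i\<in>{0..n}. d \<otimes> v i)"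
      unfolding proj_rel_def by blast
    have "w = (\<lambda>i\<in>{0..n}. (d \<otimes> c) \<otimes> u i)"
      unfolding eq v using c d nonzero_vectors_carrier[OF u]
      by (intro restrict_ext) (simp add: m_assoc)
    moreover have "d \<otimes> c \<in> carrier R - {\<zero>}"
      using c d by (simp add: integral_iff)
    ultimately show "(u, w) \<in> proj_rel R n"
      using u w unfolding proj_rel_def by blast
  qed
qed

lemma field_complex_field: "field complex_field"
proof (rule cring.cring_fieldI)
  show "cring complex_field"
  proof (rule cringI)
    show "abelian_group complex_field"
    proof (rule abelian_groupI)
      fix x assume "x \<in> carrier complex_field"
      show "\<exists>y\<in>carrier complex_field. y \<oplus>\<^bsub>complex_field\<^esub> x = \<zero>\<^bsub>complex_field\<^esub>"
        by (rule bexI[of _ "- x"]) (simp_all add: complex_field_def)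
    qed (simp_all add: complex_field_def)
    show "comm_monoid complex_field"
      by (rule comm_monoidI) (simp_all add: complex_field_def)
  qed (simp_all add: complex_field_def algebra_simps)
  have "\<exists>y. y * x = 1 \<and> x * y = 1" if "x \<noteq> 0" for x :: complex
    using that by (intro exI[of _ "1 / x"]) simp
  then show "Units complex_field = carrier complex_field - {\<zero>\<^bsub>complex_field\<^esub>}"
    by (auto simp: complex_field_def Units_def)
qed


definition line_coords :: "('a, 'm) ring_scheme \<Rightarrow> 'a option \<Rightarrow> nat \<Rightarrow> 'a"
  where "line_coords K x = (\<lambda>i\<in>{0..1}. case x of
    None \<Rightarrow> if i = 0 then \<zero>\<^bsub>K\<^esub> else \<one>\<^bsub>K\<^esub> | Some c \<Rightarrow> if i = 0 then \<one>\<^bsub>K\<^esub> else c)"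

text \<open>Dividing by the first coordinate, or by the second if the first is zero, identifies the
projective line with the field and one point at infinity.\<close>

lemma (in field) bij_betw_projective_line:
  "bij_betw (\<lambda>x. proj_rel R 1 `` {line_coords R x}) (insert None (Some ` carrier R)) (proj_space R 1)"
proof (rule bij_betw_imageI)
  let ?T = "insert None (Some ` carrier R)"
  have V: "line_coords R x \<in> nonzero_vectors R 1" if "x \<in> ?T" for x
  proof -
    have "line_coords R x \<in> {0..1} \<rightarrow>\<^sub>E carrier R"
      using that by (auto simp: line_coords_def split: option.split)
    moreover have "line_coords R x 0 \<noteq> \<zero> \<or> line_coords R x 1 \<noteq> \<zero>"
      by (cases x) (simp_all add: line_coords_def)
    ultimately show ?thesis
      by (auto simp: nonzero_vectors_def)
  qed
  note class_eq = eq_equiv_class_iff[OF equiv_proj_rel]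
  show "inj_on (\<lambda>x. proj_rel R 1 `` {line_coords R x}) ?T"
  proof (rule inj_onI)
    fix x y assume x: "x \<in> ?T" and y: "y \<in> ?T"
      and "proj_rel R 1 `` {line_coords R x} = proj_rel R 1 `` {line_coords R y}"
    then have "(line_coords R x, line_coords R y) \<in> proj_rel R 1"
      using class_eq[OF V[OF x] V[OF y]] by blast
    then obtain c where c: "c \<in> carrier R" "c \<noteq> \<zero>"
      and eq: "line_coords R y = (\<lambda>i\<in>{0..1}. c \<otimes> line_coords R x i)"
      by (auto simp: proj_rel_def)
    have "line_coords R y 0 = c \<otimes> line_coords R x 0" "line_coords R y 1 = c \<otimes> line_coords R x 1"
      by (subst eq, simp)+
    then show "x = y"
      using c x y by (auto simp: line_coords_def)
  qed
  show "(\<lambda>x. proj_rel R 1 `` {line_coords R x}) ` ?T = proj_space R 1"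
  proof
    show "(\<lambda>x. proj_rel R 1 `` {line_coords R x}) ` ?T \<subseteq> proj_space R 1"
      unfolding proj_space_quotient using V by (auto intro!: quotientI)
    show "proj_space R 1 \<subseteq> (\<lambda>x. proj_rel R 1 `` {line_coords R x}) ` ?T"
    proof
      fix P assume "P \<in> proj_space R 1"
      then obtain v where v: "v \<in> nonzero_vectors R 1" and P: "P = proj_rel R 1 `` {v}"
        unfolding proj_space_quotient by (rule quotientE)
      have vc: "v 0 \<in> carrier R" "v 1 \<in> carrier R"
        using nonzero_vectors_carrier[OF v] by auto
      have ext: "v = (\<lambda>i\<in>{0..1}. w i)" if "v 0 = w 0" "v 1 = w 1" for w
        using v that by (auto simp: nonzero_vectors_def PiE_def extensional_def fun_eq_iff le_Suc_eq)
      have *: "P \<in> (\<lambda>x. proj_rel R 1 `` {line_coords R x}) ` ?T"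
        if "x \<in> ?T" "c \<in> carrier R" "c \<noteq> \<zero>" "v 0 = c \<otimes> line_coords R x 0" "v 1 = c \<otimes> line_coords R x 1" for x c
      proof -
        have "(line_coords R x, v) \<in> proj_rel R 1"
          using V[OF that(1)] v that(2,3) ext[OF that(4,5)] unfolding proj_rel_def by blast
        then have "P = proj_rel R 1 `` {line_coords R x}"
          using class_eq[OF V[OF that(1)] v] by (simp add: P)
        with that(1) show ?thesis by blast
      qed
      show "P \<in> (\<lambda>x. proj_rel R 1 `` {line_coords R x}) ` ?T"
      proof (cases "v 0 = \<zero>")
        case True
        obtain i where "i \<le> 1" "v i \<noteq> \<zero>" using nonzero_vectors_nonzero[OF v] .
        with True have "v 1 \<noteq> \<zero>" by (cases i) auto
        then show ?thesis
          using True vc by (intro *[of None "v 1"]) (simp_all add: line_coords_def)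
      next
        case False
        then have u: "v 0 \<in> Units R" using vc by (simp add: field_Units)
        have "v 0 \<otimes> (inv (v 0) \<otimes> v 1) = v 1"
          using u vc by (simp add: m_assoc[symmetric])
        then show ?thesis
          using False vc u by (intro *[of "Some (inv (v 0) \<otimes> v 1)" "v 0"]) (simp_all add: line_coords_def)
      qed
    qed
  qed
qed

text \<open>The first coordinate of every \<open>normal_coords\<close> is \<open>1\<close>, so proportional ones are equal; the next
coordinate, \<open>0\<close> or \<open>2 \<zeta>^c\<close>, then distinguishes all of them.\<close>

lemma bij_betw_clifford_points:
  fixes p :: nat
  assumes p: "prime p" "p \<ge> 5"
  shows "bij_betw (\<lambda>x. proj_rel complex_field ((p - 1) div 2) `` {normal_coords p x})
    (insert None (Some ` {0..<int p}))
    {P \<in> proj_space complex_field ((p - 1) div 2). \<exists>a\<in>P. clifford_algebra p a \<simeq>\<^sub>a\<^sub>l\<^sub>g quantum_space p}"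
    (is "bij_betw ?cls ?T ?Pts")
proof (rule bij_betw_imageI)
  let ?n = "(p - 1) div 2"
  have p0: "p > 0" and odd: "odd p" using p prime_odd_nat[of p] by auto
  have n1: "1 \<le> ?n" using p by simp
  have V: "normal_coords p x \<in> nonzero_vectors complex_field ?n" for x
  proof -
    have "normal_coords p x 0 \<noteq> 0" by (simp add: normal_coords_def)
    then have "normal_coords p x \<noteq> (\<lambda>i\<in>{0..?n}. 0)" by (metis atLeastAtMost_iff le0 restrict_apply')
    then show ?thesis
      by (simp add: nonzero_vectors_def complex_field_def normal_coords_def)
  qed
  note equiv = field.equiv_proj_rel[OF field_complex_field, of ?n]
  note class_eq = eq_equiv_class_iff[OF equiv]
  show "inj_on ?cls ?T"
  proof (rule inj_onI)
    fix x y assume x: "x \<in> ?T" and y: "y \<in> ?T" and "?cls x = ?cls y"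
    then have "(normal_coords p x, normal_coords p y) \<in> proj_rel complex_field ?n"
      using class_eq[OF V V] by blast
    then obtain s where eq: "normal_coords p y = (\<lambda>i\<in>{0..?n}. s * normal_coords p x i)"
      by (auto simp: proj_rel_def complex_field_def)
    have "normal_coords p y 0 = s * normal_coords p x 0"
      by (subst eq) simp
    then have "s = 1" by (simp add: normal_coords_def)
    moreover have "normal_coords p y 1 = s * normal_coords p x 1"
      using n1 by (subst eq) simp
    ultimately have "normal_coords p y 1 = normal_coords p x 1" by simp
    then show "x = y"
      using n1 x y p0
      by (auto simp: normal_coords_def unity_root_eq_iff split: option.splits dest: cong_less_imp_eq_int)
  qed
  show "?cls ` ?T = ?Pts"
  proof
    show "?cls ` ?T \<subseteq> ?Pts"
    proof
      fix P assume "P \<in> ?cls ` ?T"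
      then obtain x where P: "P = ?cls x" by blast
      have "P \<in> proj_space complex_field ?n"
        unfolding P proj_space_quotient by (intro quotientI V)
      moreover have "normal_coords p x \<in> P"
        unfolding P using equiv_class_self[OF equiv V] .
      moreover have "clifford_algebra p (normal_coords p x) \<simeq>\<^sub>a\<^sub>l\<^sub>g quantum_space p"
        using clifford_iso_quantum_None[OF odd] clifford_iso_quantum_Some[OF odd] by (cases x) auto
      ultimately show "P \<in> ?Pts" by blast
    qed
    show "?Pts \<subseteq> ?cls ` ?T"
    proof
      fix P assume "P \<in> ?Pts"
      then obtain a v where a: "a \<in> P" and iso: "clifford_algebra p a \<simeq>\<^sub>a\<^sub>l\<^sub>g quantum_space p"
        and v: "v \<in> nonzero_vectors complex_field ?n" and P: "P = proj_rel complex_field ?n `` {v}"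
        unfolding proj_space_quotient by (auto elim: quotientE)
      then have va: "(v, a) \<in> proj_rel complex_field ?n" by simp
      then have aV: "a \<in> nonzero_vectors complex_field ?n" by (simp add: proj_rel_def)
      obtain i0 where "i0 \<le> ?n" "a i0 \<noteq> 0"
        using nonzero_vectors_nonzero[OF aV] by (auto simp: complex_field_def)
      from coefficients_if_iso_quantum[OF p iso this] obtain x where x: "x \<in> ?T" and a0: "a 0 \<noteq> 0"
        and ax: "\<And>i. i \<le> ?n \<Longrightarrow> a i = a 0 * normal_coords p x i"
        by blast
      have a_eq: "a = (\<lambda>i\<in>{0..?n}. a 0 * normal_coords p x i)"
      proof (rule extensionalityI)
        show "a \<in> extensional {0..?n}" using aV by (simp add: nonzero_vectors_def PiE_def)
        fix i assume "i \<in> {0..?n}"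
        then show "a i = (\<lambda>i\<in>{0..?n}. a 0 * normal_coords p x i) i"
          using ax[of i] by simp
      qed simp
      have "(normal_coords p x, a) \<in> proj_rel complex_field ?n"
        unfolding proj_rel_def mem_Collect_eq prod.case
      proof (intro conjI V aV bexI)
        show "a = (\<lambda>i\<in>{0..?n}. a 0 \<otimes>\<^bsub>complex_field\<^esub> normal_coords p x i)"
          using a_eq by (simp add: complex_field_def)
        show "a 0 \<in> carrier complex_field - {\<zero>\<^bsub>complex_field\<^esub>}"
          using a0 by (simp add: complex_field_def)
      qed
      then have "?cls x = P"
        using class_eq[OF V aV] class_eq[OF v aV] va by (simp add: P)
      with x show "P \<in> ?cls ` ?T" by blast
    qed
  qed
qed

theorem theorem1p1:
  fixes p :: nat
  assumes "prime p" and "p \<ge> 5"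
  shows "let Pts = {P \<in> proj_space complex_field ((p - 1) div 2).
                      \<exists>a \<in> P. clifford_algebra p a \<simeq>\<^sub>a\<^sub>l\<^sub>g quantum_space p}
    in card Pts = p + 1 \<and>
       (\<exists>f. bij_betw f (proj_space (residue_ring (int p)) 1) Pts)"
proof -
  let ?K = "residue_ring (int p)" and ?T = "insert None (Some ` {0..<int p})"
  interpret K: residues_prime p ?K
    by unfold_locales (rule assms(1))
  have "{0..int p - 1} = {0..<int p}" by auto
  then have line: "bij_betw (\<lambda>x. proj_rel ?K 1 `` {line_coords ?K x}) ?T (proj_space ?K 1)"
    using field.bij_betw_projective_line[OF K.is_field] by (simp add: K.res_carrier_eq)
  note points = bij_betw_clifford_points[OF assms]
  have "card ?T = p + 1"
    by (subst card_insert_disjoint) (auto simp: card_image)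
  then show ?thesis
    unfolding Let_def
    using bij_betw_same_card[OF points] bij_betw_trans[OF bij_betw_inv_into[OF line] points] by auto
qed

end
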